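(* For every $k\geq 2$, there exists $C_k>0$ such that the following holds. For every function $f\colon \mathbb{N}\to\mathbb{N}$ such that $n\leq f(n)\leq r(K_n)$ for all $n$, there is a sequence $(G_n)_{n\in\mathbb{N}}$ of $k$-connected graphs such that $|V(G_n)|=n$ and $f(n)\leq r(G_n)\leq C_k f(n)$ for all $n$.
   Context: Here $k$ is an integer, $\mathbb{N}=\{1,2,3,\dots\}$, graphs are finite and simple, and $K_N$ denotes the complete graph on $N$ vertices. The Ramsey number $r(G)$ of a graph $G$ is the smallest natural number $N$ such that every red-blue colouring of the edges of $K_N$ results in a monochromatic copy of $G$. A graph is $k$-connected if deleting any set of fewer than $k$ vertices never leaves a disconnected graph (no minimum number of vertices is required, so complete graphs of every order count as $k$-connected). *)

theory Defs
  imports Complex_Main "HOL-Library.Ramsey"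
begin

record 'a sgraph =
  verts :: "'a set"
  edges :: "'a set set"

definition simple_graph :: "'a sgraph \<Rightarrow> bool" where
  "simple_graph G \<longleftrightarrow> finite (verts G) \<and> edges G \<subseteq> [verts G]\<^bsup>2\<^esup>"

definition complete_graph :: "nat \<Rightarrow> nat sgraph" where
  "complete_graph n = \<lparr>verts = {..<n}, edges = [{..<n}]\<^bsup>2\<^esup>\<rparr>"

definition delete_verts :: "'a sgraph \<Rightarrow> 'a set \<Rightarrow> 'a sgraph" where
  "delete_verts G S = \<lparr>verts = verts G - S, edges = {e \<in> edges G. e \<inter> S = {}}\<rparr>"

definition adjacency :: "'a sgraph \<Rightarrow> ('a \<times> 'a) set" where
  "adjacency G = {(u, v). {u, v} \<in> edges G}"

(* The graph without vertices is not disconnected. *)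
definition disconnected :: "'a sgraph \<Rightarrow> bool" where
  "disconnected G \<longleftrightarrow> (\<exists>u \<in> verts G. \<exists>v \<in> verts G. (u, v) \<notin> (adjacency G)\<^sup>*)"

(* There is no lower bound on the number of vertices, so that complete graphs of every
   order are k-connected for every k. *)
definition k_connected :: "nat \<Rightarrow> 'a sgraph \<Rightarrow> bool" where
  "k_connected k G \<longleftrightarrow>
     (\<forall>S. S \<subseteq> verts G \<and> card S < k \<longrightarrow> \<not> disconnected (delete_verts G S))"

(* Copies need not be induced. *)
definition contains_copy :: "'b sgraph \<Rightarrow> 'a sgraph \<Rightarrow> bool" where
  "contains_copy H G \<longleftrightarrow>
     (\<exists>\<phi>. inj_on \<phi> (verts G) \<and> \<phi> ` verts G \<subseteq> verts H \<and> (\<forall>e \<in> edges G. \<phi> ` e \<in> edges H))"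

datatype colour = Red | Blue

definition colour_class :: "'a sgraph \<Rightarrow> ('a set \<Rightarrow> colour) \<Rightarrow> colour \<Rightarrow> 'a sgraph" where
  "colour_class H c i = \<lparr>verts = verts H, edges = {e \<in> edges H. c e = i}\<rparr>"

(* Values of the colouring outside the edge set of the complete graph are irrelevant. *)
definition ramsey_arrows :: "nat \<Rightarrow> 'a sgraph \<Rightarrow> bool" where
  "ramsey_arrows N G \<longleftrightarrow>
     (\<forall>c :: nat set \<Rightarrow> colour. \<exists>i. contains_copy (colour_class (complete_graph N) c i) G)"

definition ramsey_number :: "'a sgraph \<Rightarrow> nat" where
  "ramsey_number G = (LEAST N. 1 \<le> N \<and> ramsey_arrows N G)"

text \<open>By Ramsey's theorem, the minimum in \<^const>\<open>ramsey_number\<close> is attained.\<close>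

lemma ex_ramsey_arrows:
  assumes "simple_graph G"
  shows "\<exists>N\<ge>1. ramsey_arrows N G"
proof -
  let ?m = "card (verts G)"
  have fin: "finite (verts G)" and E: "edges G \<subseteq> [verts G]\<^bsup>2\<^esup>"
    using assms by (auto simp: simple_graph_def)
  obtain N :: nat where "N \<ge> 1" and N: "partn_lst {..<N} [?m, ?m] 2"
  proof -
    obtain N :: nat where N: "partn_lst {..<N} [?m, ?m] 2"
      using that[OF ramsey2_full] .
    have "partn_lst {..<Suc N} [?m, ?m] 2"
      by (rule partn_lst_greater_resource[OF N]) auto
    then show thesis using that[of "Suc N"] by simp
  qed
  have "\<exists>i. contains_copy (colour_class (complete_graph N) c i) G" for c :: "nat set \<Rightarrow> colour"
  proof -
    define f where "f = (\<lambda>e. if c e = Red then 0 else (1::nat))"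
    have "f \<in> [{..<N}]\<^bsup>2\<^esup> \<rightarrow> {..<length [?m, ?m]}"
      by (auto simp: f_def)
    with N obtain i where "i < 2" and "monochromatic {..<N} ([?m, ?m] ! i) 2 f i"
      unfolding partn_lst_def by (metis One_nat_def Suc_1 length_Cons list.size(3))
    moreover from \<open>i < 2\<close> have "[?m, ?m] ! i = ?m"
      by (cases i) auto
    ultimately obtain H where H: "H \<in> [{..<N}]\<^bsup>?m\<^esup>" and f: "f ` [H]\<^bsup>2\<^esup> \<subseteq> {i}"
      unfolding monochromatic_def by auto
    define col where "col = (if i = 0 then Red else Blue)"
    have c: "c e = col" if "e \<in> [H]\<^bsup>2\<^esup>" for e
    proof -
      from that f have "f e = i" by blast
      then show ?thesis
        by (cases "c e") (auto simp: f_def col_def split: if_splits)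
    qed
    obtain \<phi> where \<phi>: "bij_betw \<phi> (verts G) H"
      using H fin finite_same_card_bij[of "verts G" H] by (auto simp: nsets_def)
    have img: "\<phi> ` e \<in> [H]\<^bsup>2\<^esup>" if "e \<in> edges G" for e
      using bij_betw_nsets[OF \<phi>, of 2] that E by (auto simp: bij_betw_def)
    have "H \<subseteq> {..<N}"
      using H by (auto simp: nsets_def)
    then have "[H]\<^bsup>2\<^esup> \<subseteq> [{..<N}]\<^bsup>2\<^esup>"
      by (rule nsets_mono)
    with img c have "\<phi> ` e \<in> edges (colour_class (complete_graph N) c col)" if "e \<in> edges G" for e
      using that by (auto simp: colour_class_def complete_graph_def)
    moreover have "\<phi> ` verts G \<subseteq> verts (colour_class (complete_graph N) c col)"
      using \<phi> \<open>H \<subseteq> {..<N}\<close> by (auto simp: bij_betw_def colour_class_def complete_graph_def)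
    ultimately have "contains_copy (colour_class (complete_graph N) c col) G"
      using \<phi> unfolding contains_copy_def bij_betw_def by blast
    then show ?thesis ..
  qed
  then show ?thesis
    using \<open>N \<ge> 1\<close> by (auto simp: ramsey_arrows_def)
qed

end

theory Submission
  imports Defs
begin

text \<open>
  For given \<open>n\<close>, the aim is a family of \<open>k\<close>-connected graphs on \<open>n\<close> vertices whose Ramsey numbers run
  from \<open>n\<close> to that of the complete graph, up to constants, without a gap of more than a constant
  factor. Two families are combined.

  Up to the power \<open>n ^ (2 * k + 4)\<close> these are the complete bipartite graphs with \<open>s\<close> and \<open>n - s\<close>
  vertices in the two classes. For \<open>s\<close> of order \<open>log n\<close> their Ramsey number is \<open>2 ^ s * n\<close> up to constant
  factors, by a random colouring (\<open>ramsey_number_biclique_lower\<close>) and by a greedy choice of the small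
  class (\<open>ramsey_number_biclique_upper\<close>).

  Above that power they are the graphs \<open>planted_clique k m n\<close>: a clique on \<open>m\<close> vertices, \<open>k\<close> of which are
  joined to all other vertices. Their Ramsey number is at least that of the clique, and all depends on
  showing that it is bounded by a constant times that of the clique on \<open>m - 1\<close> vertices, or times
  the power of \<open>n\<close> (\<open>ramsey_number_planted_clique_upper\<close>). In particular, adding a vertex to a clique
  multiplies its Ramsey number by at most a constant.

  The reason is as follows. Chasing majority neighbourhoods gives a clique of \<open>k\<close> vertices, red say,
  that is joined in red to a positive fraction of all vertices. Chasing blue neighbourhoods inside
  this set either gives \<open>k\<close> further vertices, forming a blue clique and joined in blue to a large
  set, or gets stuck. In the first case a monochromatic clique on \<open>m - 1\<close> vertices in the last set can
  be extended in red as well as in blue. In the second case blue is sparse on a large set \<open>U\<close>. By the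
  argument of Erdos and Szemeredi, two-colourings with a sparse colour have much larger monochromatic
  cliques than general ones. More precisely, either \<open>U\<close> has a red clique on \<open>m - 1\<close> vertices, which the
  first \<open>k\<close> vertices extend, or a large part of \<open>U\<close> has red cliques of size at most \<open>m / 81\<close>
  only, and then the Erdos--Szekeres bound gives blue cliques in it, even in the common
  blue neighbourhood of \<open>k\<close> vertices. What makes the constants fit is that the Ramsey number of a
  clique is exponential in its size.
\<close>

section \<open>Cliques and books in a two-coloured complete graph\<close>

definition mono_clique :: "('a set \<Rightarrow> colour) \<Rightarrow> colour \<Rightarrow> 'a set \<Rightarrow> bool" where
  "mono_clique c i A \<longleftrightarrow> (\<forall>u\<in>A. \<forall>v\<in>A. u \<noteq> v \<longrightarrow> c {u, v} = i)"

definition nbrs :: "('a set \<Rightarrow> colour) \<Rightarrow> colour \<Rightarrow> 'a set \<Rightarrow> 'a \<Rightarrow> 'a set" where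
  "nbrs c i A v = {w \<in> A. w \<noteq> v \<and> c {v, w} = i}"

text \<open>
  A spine \<open>X\<close>, which is a clique, joined completely to a set \<open>W\<close> of pages. Taking the
  neighbourhood inside \<open>W\<close> makes spine and pages disjoint.
\<close>

definition book :: "('a set \<Rightarrow> colour) \<Rightarrow> colour \<Rightarrow> 'a set \<Rightarrow> 'a set \<Rightarrow> bool" where
  "book c i X W \<longleftrightarrow> mono_clique c i X \<and> (\<forall>x\<in>X. W \<subseteq> nbrs c i W x)"

lemma colour_neq_iff:
  fixes x :: colour
  assumes "i \<noteq> j"
  shows "x \<noteq> i \<longleftrightarrow> x = j"
  using assms by (cases x; cases i; cases j) auto

lemma nbrs_subset: "nbrs c i A v \<subseteq> A"
  by (auto simp: nbrs_def)

lemma finite_nbrs [simp]: "finite A \<Longrightarrow> finite (nbrs c i A v)"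
  by (simp add: nbrs_def)

lemma mono_clique_subset: "mono_clique c i A \<Longrightarrow> B \<subseteq> A \<Longrightarrow> mono_clique c i B"
  by (auto simp: mono_clique_def)

lemma mono_clique_Un:
  assumes "mono_clique c i A" "mono_clique c i B" "\<And>a b. a \<in> A \<Longrightarrow> b \<in> B \<Longrightarrow> c {a, b} = i"
  shows "mono_clique c i (A \<union> B)"
  using assms unfolding mono_clique_def by (metis UnE insert_commute)

lemma book_empty [simp]: "book c i {} W"
  by (simp add: book_def mono_clique_def)

lemma book_edge: "book c i X W \<Longrightarrow> x \<in> X \<Longrightarrow> w \<in> W \<Longrightarrow> w \<noteq> x \<and> c {x, w} = i"
  by (auto simp: book_def nbrs_def)

lemma book_disjoint: "book c i X W \<Longrightarrow> X \<inter> W = {}"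
  by (auto simp: book_def nbrs_def)

lemma book_antimono: "book c i X W \<Longrightarrow> W' \<subseteq> W \<Longrightarrow> book c i X W'"
  by (auto simp: book_def nbrs_def)

lemma book_insert:
  assumes "book c i X W" "X \<subseteq> nbrs c i A v" "W \<subseteq> nbrs c i A v"
  shows "book c i (insert v X) W"
  using assms unfolding book_def nbrs_def mono_clique_def
  by (auto simp: insert_commute)

lemma card_nbrs_split:
  assumes "finite A" "v \<in> A" "i \<noteq> j"
  shows "card A = Suc (card (nbrs c i A v) + card (nbrs c j A v))"
proof -
  have "A - {v} = nbrs c i A v \<union> nbrs c j A v" and "nbrs c i A v \<inter> nbrs c j A v = {}"
    using colour_neq_iff[OF assms(3)] assms(3) by (auto simp: nbrs_def)
  then have "card (A - {v}) = card (nbrs c i A v) + card (nbrs c j A v)"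
    using assms(1) by (simp add: card_Un_disjoint)
  then show ?thesis
    using assms by (metis card.remove)
qed

text \<open>
  Neighbourhood chasing: a vertex has a majority colour in the current set of pages, and passing
  to its neighbourhood in that colour costs a factor 2. After \<open>p + q - 1\<close> steps some colour has been
  the majority colour \<open>p\<close> (respectively \<open>q\<close>) times.
\<close>

lemma ex_large_book:
  assumes "finite A" "i \<noteq> j" "1 \<le> M" "2 ^ (p + q) * M \<le> card A"
  shows "\<exists>X W. X \<subseteq> A \<and> W \<subseteq> A \<and> M \<le> card W \<and>
    (book c i X W \<and> card X = p \<or> book c j X W \<and> card X = q)"
  using assms
proof (induction "p + q" arbitrary: p q A)
  case 0
  then show ?case by (intro exI[of _ "{}"] exI[of _ A]) auto
next
  case (Suc s)
  show ?case
  proof (cases "p = 0 \<or> q = 0")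
    case True
    have "1 * M \<le> 2 ^ (p + q) * M" by (intro mult_right_mono) auto
    with Suc.prems(4) have "M \<le> card A" by linarith
    with True show ?thesis
      by (intro exI[of _ "{}"] exI[of _ A]) auto
  next
    case False
    have *: "2 ^ (p + q) * M = 2 * (2 ^ s * M)"
      using Suc.hyps(2) by (metis mult.assoc power_Suc)
    have "0 < card A"
      using Suc.prems by (metis gr0I le_0_eq mult_is_0 not_one_le_zero power_not_zero zero_neq_numeral)
    then obtain v where v: "v \<in> A"
      by (metis card_gt_0_iff ex_in_conv)
    let ?P = "nbrs c i A v" and ?Q = "nbrs c j A v"
    have fin: "finite ?P" "finite ?Q" and sub: "?P \<subseteq> A" "?Q \<subseteq> A"
      and ni: "v \<notin> ?P" "v \<notin> ?Q"
      using Suc.prems(1) by (auto simp: nbrs_def)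
    have "2 ^ s * M \<le> card ?P \<or> 2 ^ s * M \<le> card ?Q"
      using card_nbrs_split[OF Suc.prems(1) v Suc.prems(2), of c] Suc.prems(4) * by linarith
    then show ?thesis
    proof
      assume large: "2 ^ s * M \<le> card ?P"
      have e: "s = (p - 1) + q" using Suc.hyps(2) False by simp
      obtain X W where XW: "X \<subseteq> ?P" "W \<subseteq> ?P" "M \<le> card W"
        "book c i X W \<and> card X = p - 1 \<or> book c j X W \<and> card X = q"
        using Suc.hyps(1)[OF e fin(1) Suc.prems(2,3)] large unfolding e[symmetric] by blast
      from XW(4) show ?thesis
      proof
        assume "book c i X W \<and> card X = p - 1"
        then have "book c i (insert v X) W" "card (insert v X) = p"
          using book_insert XW ni(1) False finite_subset[OF XW(1) fin(1)] by (auto simp: card_insert_if)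
        moreover have "insert v X \<subseteq> A" "W \<subseteq> A" using XW sub v by auto
        ultimately show ?thesis using XW(3) by blast
      next
        assume "book c j X W \<and> card X = q"
        moreover have "X \<subseteq> A" "W \<subseteq> A" using XW(1,2) sub by auto
        ultimately show ?thesis using XW(3) by blast
      qed
    next
      assume large: "2 ^ s * M \<le> card ?Q"
      have e: "s = p + (q - 1)" using Suc.hyps(2) False by simp
      obtain X W where XW: "X \<subseteq> ?Q" "W \<subseteq> ?Q" "M \<le> card W"
        "book c i X W \<and> card X = p \<or> book c j X W \<and> card X = q - 1"
        using Suc.hyps(1)[OF e fin(2) Suc.prems(2,3)] large unfolding e[symmetric] by blast
      from XW(4) show ?thesis
      proof
        assume "book c j X W \<and> card X = q - 1"
        then have "book c j (insert v X) W" "card (insert v X) = q"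
          using book_insert XW ni(2) False finite_subset[OF XW(1) fin(2)] by (auto simp: card_insert_if)
        moreover have "insert v X \<subseteq> A" "W \<subseteq> A" using XW sub v by auto
        ultimately show ?thesis using XW(3) by blast
      next
        assume "book c i X W \<and> card X = p"
        moreover have "X \<subseteq> A" "W \<subseteq> A" using XW(1,2) sub by auto
        ultimately show ?thesis using XW(3) by blast
      qed
    qed
  qed
qed

text \<open>
  The same chase in colour \<open>j\<close> alone, with a factor \<open>q\<close> per step. It can only get stuck in a set in
  which all degrees of colour \<open>j\<close> are smaller than a fraction \<open>1 / q\<close> of the set.
\<close>

lemma large_book_or_sparse:
  assumes "finite A" "1 \<le> q" "q ^ p * M \<le> card A"
  shows "(\<exists>X W. X \<subseteq> A \<and> W \<subseteq> A \<and> M \<le> card W \<and> book c j X W \<and> card X = p) \<or>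
    (\<exists>U\<subseteq>A. M \<le> card U \<and> (\<forall>v\<in>U. q * card (nbrs c j U v) < card U))"
  using assms
proof (induction p arbitrary: A)
  case 0
  then show ?case by (intro disjI1 exI[of _ "{}"] exI[of _ A]) auto
next
  case (Suc p)
  show ?case
  proof (cases "\<forall>v\<in>A. q * card (nbrs c j A v) < card A")
    case True
    have "1 * M \<le> q ^ Suc p * M" using Suc.prems(2) by (intro mult_right_mono one_le_power) auto
    then have "M \<le> card A" using Suc.prems(3) by linarith
    with True show ?thesis by blast
  next
    case False
    then obtain v where v: "v \<in> A" "card A \<le> q * card (nbrs c j A v)" by (auto simp: not_less)
    let ?P = "nbrs c j A v"
    have "q * (q ^ p * M) \<le> card A" using Suc.prems(3) by (simp add: mult.assoc)
    then have "q * (q ^ p * M) \<le> q * card ?P" using v(2) by linarith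
    then have "q ^ p * M \<le> card ?P" using Suc.prems(2) by simp
    moreover have fin: "finite ?P" using Suc.prems(1) by simp
    ultimately consider X W where "X \<subseteq> ?P" "W \<subseteq> ?P" "M \<le> card W" "book c j X W" "card X = p"
      | U where "U \<subseteq> ?P" "M \<le> card U" "\<forall>v\<in>U. q * card (nbrs c j U v) < card U"
      using Suc.IH[of ?P] Suc.prems(2) by blast
    then show ?thesis
    proof cases
      case 1
      have "v \<notin> X" using 1(1) by (auto simp: nbrs_def)
      then have "card (insert v X) = Suc p"
        using 1(5) finite_subset[OF 1(1) fin] by simp
      moreover have "book c j (insert v X) W" by (rule book_insert[OF 1(4,1,2)])
      moreover have "insert v X \<subseteq> A" "W \<subseteq> A" using 1(1,2) v(1) nbrs_subset[of c j A v] by auto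
      ultimately show ?thesis using 1(3) by blast
    next
      case 2
      moreover have "U \<subseteq> A" using 2(1) nbrs_subset[of c j A v] by blast
      ultimately show ?thesis by blast
    qed
  qed
qed

lemma ex_maximum_clique:
  assumes "finite A"
  obtains I where "I \<subseteq> A" "mono_clique c i I"
    "\<And>J. J \<subseteq> A \<Longrightarrow> mono_clique c i J \<Longrightarrow> card J \<le> card I"
proof -
  have "\<exists>I. (I \<subseteq> A \<and> mono_clique c i I) \<and> (\<forall>J. J \<subseteq> A \<and> mono_clique c i J \<longrightarrow> card J \<le> card I)"
    by (rule ex_has_greatest_nat[where k = "{}" and b = "Suc (card A)"])
      (use assms in \<open>auto simp: mono_clique_def card_mono less_Suc_eq_le\<close>)
  then show thesis using that by blast
qed

lemma mono_clique_subset_card: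
  assumes "mono_clique c i J" "J \<subseteq> A" "d \<le> card J"
  obtains J' where "J' \<subseteq> A" "mono_clique c i J'" "card J' = d"
  using assms by (metis mono_clique_subset obtain_subset_with_card_n order_trans)

text \<open>
  A maximum clique of colour \<open>i\<close> dominates the set in colour \<open>j\<close>; when the degrees of colour \<open>j\<close>
  are small, few vertices cannot dominate.
\<close>

lemma clique_in_sparse_complement:
  assumes "finite U" "i \<noteq> j" and sparse: "\<And>v. v \<in> U \<Longrightarrow> q * card (nbrs c j U v) < card U"
    and large: "q * q < card U"
  shows "\<exists>J\<subseteq>U. mono_clique c i J \<and> card J = q"
proof (rule ccontr)
  assume no: "\<not> ?thesis"
  obtain I where I: "I \<subseteq> U" "mono_clique c i I"
    and max: "\<And>J. J \<subseteq> U \<Longrightarrow> mono_clique c i J \<Longrightarrow> card J \<le> card I"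
    using ex_maximum_clique[OF assms(1)] by blast
  have finI: "finite I" using I(1) assms(1) finite_subset by blast
  have Iq: "card I < q" using no mono_clique_subset_card[OF I(2,1)] by (metis not_less)
  have "U \<subseteq> I \<union> (\<Union>v\<in>I. nbrs c j U v)"
  proof
    fix w assume w: "w \<in> U"
    show "w \<in> I \<union> (\<Union>v\<in>I. nbrs c j U v)"
    proof (rule ccontr)
      assume a: "\<not> ?thesis"
      then have "c {v, w} = i" if "v \<in> I" for v
        using that w colour_neq_iff[OF assms(2), of "c {v, w}"] by (auto simp: nbrs_def)
      then have "mono_clique c i (I \<union> {w})"
        using I(2) by (intro mono_clique_Un) (auto simp: mono_clique_def)
      then have "card (insert w I) \<le> card I" using max[of "insert w I"] I(1) w by simp
      then show False using a finI by simp
    qed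
  qed
  then have "card U \<le> card (I \<union> (\<Union>v\<in>I. nbrs c j U v))"
    using assms(1) finI by (intro card_mono) auto
  also have "\<dots> \<le> card I + card (\<Union>v\<in>I. nbrs c j U v)" by (rule card_Un_le)
  also have "\<dots> \<le> card I + (\<Sum>v\<in>I. card (nbrs c j U v))"
    using card_UN_le[OF finI] by auto
  finally have "q * card U \<le> q * card I + (\<Sum>v\<in>I. q * card (nbrs c j U v))"
    by (metis distrib_left mult_le_mono2 sum_distrib_left)
  also have "\<dots> \<le> q * card I + (\<Sum>v\<in>I. card U)"
    using sparse I(1) by (intro add_left_mono sum_mono) (meson less_imp_le subsetD)
  also have "\<dots> = q * card I + card I * card U" by simp
  finally have 1: "q * card U \<le> q * card I + card I * card U" .
  have "Suc (card I) * card U \<le> q * card U" using Iq by (intro mult_right_mono) auto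
  then have "card U \<le> q * card I" using 1 by simp
  also have "\<dots> \<le> q * q" using Iq by simp
  finally show False using large by simp
qed

section \<open>Sets that are sparse in one colour\<close>

text \<open>
  One binomial coefficient bounds both this number of subsets and, later, an off-diagonal Ramsey
  number, so that a single estimate serves for the two.
\<close>

lemma card_small_subsets:
  assumes "finite I"
  shows "card {D. D \<subseteq> I \<and> card D < d} \<le> (card I + d) choose d"
proof -
  have "{D. D \<subseteq> I \<and> card D < d} \<subseteq> (\<Union>e\<le>d. [I]\<^bsup>e\<^esup>)"
    using assms by (auto simp: nsets_def finite_subset)
  then have "card {D. D \<subseteq> I \<and> card D < d} \<le> card (\<Union>e\<le>d. [I]\<^bsup>e\<^esup>)"
    using assms by (intro card_mono) (auto simp: finite_imp_finite_nsets)
  also have "\<dots> \<le> (\<Sum>e\<le>d. card ([I]\<^bsup>e\<^esup>))" by (rule card_UN_le) simp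
  also have "\<dots> \<le> (\<Sum>e\<le>d. (card I choose e) * (d choose (d - e)))"
    by (intro sum_mono) (simp add: Suc_leI)
  also have "\<dots> = (card I + d) choose d" by (rule vandermonde)
  finally show ?thesis .
qed

text \<open>
  The step from the theorem of Erdos and Szemeredi. Let \<open>I\<close> be a maximum clique of colour \<open>i\<close>.
  As colour \<open>j\<close> is sparse, at least half of the vertices send fewer than \<open>d\<close> edges of colour \<open>j\<close> to
  \<open>I\<close>, and by pigeonhole many of them have the same neighbourhood \<open>D\<close> of colour \<open>j\<close> in \<open>I\<close>. A clique of
  size \<open>d\<close> among those could replace \<open>D\<close> in \<open>I\<close> and would give a larger clique. The point is that
  the pigeonhole principle is applied to small subsets of \<open>I\<close> only, of which there are few.
\<close>

lemma large_subset_with_small_cliques: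
  assumes "finite U" "i \<noteq> j"
    and sparse: "\<And>v. v \<in> U \<Longrightarrow> 2 * q * card (nbrs c j U v) < card U"
    and d: "m \<le> q * d" and large: "4 * m \<le> card U"
    and no: "\<nexists>J. J \<subseteq> U \<and> mono_clique c i J \<and> card J = m"
  shows "\<exists>W\<subseteq>U. (\<nexists>J. J \<subseteq> W \<and> mono_clique c i J \<and> card J = d) \<and>
    card U \<le> 4 * (((m + d) choose d) * card W)"
proof -
  obtain I where I: "I \<subseteq> U" "mono_clique c i I"
    and max: "\<And>J. J \<subseteq> U \<Longrightarrow> mono_clique c i J \<Longrightarrow> card J \<le> card I"
    using ex_maximum_clique[OF assms(1)] by blast
  have finI: "finite I" using I(1) assms(1) finite_subset by blast
  have Im: "card I < m" using no mono_clique_subset_card[OF I(2,1)] by (metis not_less)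
  define T where "T w = nbrs c j I w" for w
  \<comment> \<open>heavy and light vertices, by their degree of colour \<open>j\<close> into \<open>I\<close>\<close>
  define H where "H = {w \<in> U - I. d \<le> card (T w)}"
  define L where "L = U - I - H"
  have fin: "finite H" "finite L" using assms(1) by (auto simp: H_def L_def)
  \<comment> \<open>double counting of the edges of colour \<open>j\<close> between \<open>I\<close> and \<open>H\<close>\<close>
  have "2 * card H \<le> card U"
  proof -
    have "card H * d = (\<Sum>w\<in>H. d)" by simp
    also have "\<dots> \<le> (\<Sum>w\<in>H. card (T w))" by (intro sum_mono) (auto simp: H_def)
    also have "\<dots> = (\<Sum>v\<in>I. card {w \<in> H. v \<in> T w})"
    proof -
      have "(\<Sum>w\<in>H. card (T w)) = (\<Sum>w\<in>H. card {v \<in> I. v \<in> T w})"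
        by (intro sum.cong arg_cong[where f = card]) (auto simp: T_def nbrs_def)
      also have "\<dots> = (\<Sum>v\<in>I. card {w \<in> H. v \<in> T w})"
        using sum_multicount_gen[OF fin(1) finI, of "\<lambda>w v. v \<in> T w" "\<lambda>v. card {w \<in> H. v \<in> T w}"] by auto
      finally show ?thesis .
    qed
    also have "\<dots> \<le> (\<Sum>v\<in>I. card (nbrs c j U v))"
      using assms(1) by (intro sum_mono card_mono) (auto simp: T_def H_def nbrs_def insert_commute)
    finally have "2 * q * (card H * d) \<le> (\<Sum>v\<in>I. 2 * q * card (nbrs c j U v))"
      by (metis mult_le_mono2 sum_distrib_left)
    also have "\<dots> \<le> (\<Sum>v\<in>I. card U)"
      using sparse I(1) by (intro sum_mono) (meson less_imp_le subsetD)
    also have "\<dots> = card I * card U" by simp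
    also have "\<dots> \<le> (q * d) * card U" using Im d by (intro mult_right_mono) auto
    finally have "(q * d) * (2 * card H) \<le> (q * d) * card U" by (simp add: algebra_simps)
    moreover have "0 < q * d" using Im d by linarith
    ultimately show ?thesis by simp
  qed
  moreover have "card U = card I + card H + card L"
  proof -
    have "U = I \<union> (H \<union> L)" "I \<inter> (H \<union> L) = {}" "H \<inter> L = {}"
      using I(1) by (auto simp: H_def L_def)
    then show ?thesis using fin finI by (metis card_Un_disjoint finite_Un add.assoc)
  qed
  ultimately have cL: "card U \<le> 4 * card L" using Im large by linarith
  define F where "F = {D. D \<subseteq> I \<and> card D < d}"
  have finF: "finite F" using finI by (simp add: F_def)
  have TF: "T \<in> L \<rightarrow> F" by (auto simp: L_def H_def F_def T_def nbrs_def)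
  have "L \<noteq> {}" using cL large Im by auto
  then have "F \<noteq> {}" using TF by auto
  then obtain D where D: "D \<in> F" "card L \<le> card (T -` {D} \<inter> L) * card F"
    using pigeonhole_card[OF TF fin(2) finF] by blast
  define W where "W = T -` {D} \<inter> L"
  have "card F \<le> (card I + d) choose d" unfolding F_def by (rule card_small_subsets[OF finI])
  also have "\<dots> \<le> (m + d) choose d" using Im by (intro binomial_right_mono) simp
  finally have "card L \<le> card W * ((m + d) choose d)"
    using D(2) unfolding W_def[symmetric] by (meson mult_le_mono2 order_trans)
  then have "card U \<le> 4 * (((m + d) choose d) * card W)" using cL by (simp add: mult.commute)
  moreover have "W \<subseteq> U" by (auto simp: W_def L_def)
  moreover have "\<not> (J \<subseteq> W \<and> mono_clique c i J \<and> card J = d)" for J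
  proof
    assume J: "J \<subseteq> W \<and> mono_clique c i J \<and> card J = d"
    have finJ: "finite J" using J \<open>W \<subseteq> U\<close> assms(1) finite_subset by metis
    \<comment> \<open>exchanging \<open>D\<close> for \<open>J\<close> enlarges \<open>I\<close>\<close>
    have "c {a, b} = i" if "a \<in> I - D" "b \<in> J" for a b
    proof -
      have b: "b \<in> L" "T b = D" using that J by (auto simp: W_def)
      then have "a \<notin> nbrs c j I b" using that by (simp add: T_def)
      moreover have "a \<noteq> b" using that b by (auto simp: L_def)
      ultimately have "c {b, a} \<noteq> j" using that by (auto simp: nbrs_def)
      then show ?thesis using colour_neq_iff[OF assms(2)] by (auto simp: insert_commute)
    qed
    then have "mono_clique c i ((I - D) \<union> J)"
      using J I(2) by (intro mono_clique_Un) (auto intro: mono_clique_subset)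
    then have "card ((I - D) \<union> J) \<le> card I"
      using I(1) J \<open>W \<subseteq> U\<close> by (intro max) auto
    moreover have "card ((I - D) \<union> J) = card (I - D) + card J"
      using finI finJ J by (intro card_Un_disjoint) (auto simp: W_def L_def)
    moreover have "card (I - D) = card I - card D" "card D \<le> card I"
      using D(1) finI by (auto simp: F_def card_Diff_subset finite_subset card_mono)
    ultimately show False using D(1) J by (auto simp: F_def)
  qed
  ultimately show ?thesis by blast
qed

lemma erdos_szekeres_clique:
  fixes W :: "'a set"
  assumes "finite W" "i \<noteq> j" "(m + d) choose d \<le> card W"
  shows "(\<exists>J\<subseteq>W. mono_clique c i J \<and> card J = d) \<or> (\<exists>J\<subseteq>W. mono_clique c j J \<and> card J = m)"
proof -
  have "ES 2 d m \<le> card W" using assms(3) by (simp add: ES2_choose add.commute)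
  then have P: "partn_lst {..<card W} [d, m] 2"
    using partn_lst_greater_resource[OF ramsey2_full] by blast
  obtain h where h: "bij_betw h {..<card W} W"
    using ex_bij_betw_nat_finite[OF assms(1)] by (auto simp: atLeast0LessThan)
  define f where "f = (\<lambda>e. if c (h ` e) = i then 0 else (1::nat))"
  have "f \<in> [{..<card W}]\<^bsup>2\<^esup> \<rightarrow> {..<length [d, m]}" by (auto simp: f_def)
  with P obtain t where t: "t < 2" "monochromatic {..<card W} ([d, m] ! t) 2 f t"
    unfolding partn_lst_def by (metis One_nat_def Suc_1 length_Cons list.size(3))
  then obtain H where H: "H \<in> [{..<card W}]\<^bsup>([d, m] ! t)\<^esup>" "f ` [H]\<^bsup>2\<^esup> \<subseteq> {t}"
    unfolding monochromatic_def by auto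
  have sub: "H \<subseteq> {..<card W}" and cH: "card H = [d, m] ! t" using H(1) by (auto simp: nsets_def)
  then have inj: "inj_on h H" using h by (meson bij_betw_def inj_on_subset)
  have "h ` H \<subseteq> W" using sub h by (auto simp: bij_betw_def)
  moreover have "card (h ` H) = [d, m] ! t" using inj cH by (simp add: card_image)
  moreover have "mono_clique c (if t = 0 then i else j) (h ` H)"
  proof -
    have "c {h u, h v} = (if t = 0 then i else j)" if "u \<in> H" "v \<in> H" "u \<noteq> v" for u v
    proof -
      have "f {u, v} = t" using H(2) that by (auto simp: image_subset_iff)
      then show ?thesis using colour_neq_iff[OF assms(2)] by (auto simp: f_def split: if_splits)
    qed
    then show ?thesis unfolding mono_clique_def by blast
  qed
  moreover have "t = 0 \<or> t = 1" using t(1) by auto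
  ultimately show ?thesis by auto
qed

section \<open>Ramsey numbers and monochromatic copies\<close>

text \<open>
  A monochromatic copy inside an arbitrary vertex set \<open>W\<close>, so that copies can be sought in the
  pages of a book and not only in an initial segment.
\<close>

definition embeds_in_colour :: "('b set \<Rightarrow> colour) \<Rightarrow> colour \<Rightarrow> 'a sgraph \<Rightarrow> 'b set \<Rightarrow> bool" where
  "embeds_in_colour c i G W \<longleftrightarrow>
     (\<exists>\<phi>. inj_on \<phi> (verts G) \<and> \<phi> ` verts G \<subseteq> W \<and> (\<forall>e\<in>edges G. c (\<phi> ` e) = i))"

lemma contains_copy_colour_class_iff:
  assumes "simple_graph G"
  shows "contains_copy (colour_class (complete_graph N) c i) G \<longleftrightarrow> embeds_in_colour c i G {..<N}"
proof -
  have "\<phi> ` e \<in> [{..<N}]\<^bsup>2\<^esup>"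
    if "inj_on \<phi> (verts G)" "\<phi> ` verts G \<subseteq> {..<N}" "e \<in> edges G" for \<phi> e
  proof -
    have "e \<in> [verts G]\<^bsup>2\<^esup>" using assms that(3) by (auto simp: simple_graph_def)
    then show ?thesis
      using nsets_image_funcset[of \<phi> "verts G" "{..<N}" 2] that(1,2) by (auto simp: image_subset_iff)
  qed
  then show ?thesis
    unfolding contains_copy_def embeds_in_colour_def colour_class_def complete_graph_def
    by (auto; blast)
qed

lemma ramsey_arrows_iff:
  assumes "simple_graph G"
  shows "ramsey_arrows N G \<longleftrightarrow> (\<forall>c. \<exists>i. embeds_in_colour c i G {..<N})"
  using contains_copy_colour_class_iff[OF assms] by (simp add: ramsey_arrows_def)

lemma ramsey_number_arrows:
  assumes "simple_graph G"
  shows "1 \<le> ramsey_number G" "ramsey_arrows (ramsey_number G) G"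
proof -
  have "1 \<le> ramsey_number G \<and> ramsey_arrows (ramsey_number G) G"
    unfolding ramsey_number_def by (rule LeastI_ex) (use ex_ramsey_arrows[OF assms] in auto)
  then show "1 \<le> ramsey_number G" "ramsey_arrows (ramsey_number G) G" by auto
qed

lemma ex_mono_copy:
  assumes "simple_graph G" "finite W" "ramsey_number G \<le> card W"
  shows "\<exists>i. embeds_in_colour c i G W"
proof -
  obtain h where h: "inj_on h {..<ramsey_number G}" "h ` {..<ramsey_number G} \<subseteq> W"
    using card_le_inj[of "{..<ramsey_number G}" W] assms(2,3) by auto
  obtain i \<phi> where \<phi>: "inj_on \<phi> (verts G)" "\<phi> ` verts G \<subseteq> {..<ramsey_number G}"
    "\<forall>e\<in>edges G. c (h ` \<phi> ` e) = i"
    using ramsey_number_arrows(2)[OF assms(1)] unfolding ramsey_arrows_iff[OF assms(1)] embeds_in_colour_def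
    by (drule_tac x = "\<lambda>e. c (h ` e)" in spec) blast
  have "inj_on (h \<circ> \<phi>) (verts G)"
    using \<phi>(1,2) h(1) by (meson comp_inj_on inj_on_subset)
  moreover have "(h \<circ> \<phi>) ` verts G \<subseteq> W" using \<phi>(2) h(2) by fastforce
  moreover have "\<forall>e\<in>edges G. c ((h \<circ> \<phi>) ` e) = i" using \<phi>(3) by (simp add: image_comp)
  ultimately show ?thesis unfolding embeds_in_colour_def by blast
qed

lemma ramsey_number_leI:
  assumes "simple_graph G" "1 \<le> N" "\<And>c. \<exists>i. embeds_in_colour c i G {..<N}"
  shows "ramsey_number G \<le> N"
  unfolding ramsey_number_def
  by (rule Least_le) (use assms ramsey_arrows_iff[OF assms(1)] in auto)

lemma ramsey_number_gtI:
  assumes "simple_graph G" "\<And>i. \<not> embeds_in_colour c i G {..<N}"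
  shows "N < ramsey_number G"
  using ex_mono_copy[OF assms(1), of "{..<N}" c] assms(2) by fastforce

lemma ramsey_number_mono:
  assumes "simple_graph G" "contains_copy G H" "simple_graph H"
  shows "ramsey_number H \<le> ramsey_number G"
proof (rule ramsey_number_leI[OF assms(3) ramsey_number_arrows(1)[OF assms(1)]])
  fix c :: "nat set \<Rightarrow> colour"
  obtain i \<phi> where \<phi>: "inj_on \<phi> (verts G)" "\<phi> ` verts G \<subseteq> {..<ramsey_number G}"
    "\<forall>e\<in>edges G. c (\<phi> ` e) = i"
    using ex_mono_copy[OF assms(1), of "{..<ramsey_number G}" c] unfolding embeds_in_colour_def by auto
  obtain \<psi> where \<psi>: "inj_on \<psi> (verts H)" "\<psi> ` verts H \<subseteq> verts G" "\<forall>e\<in>edges H. \<psi> ` e \<in> edges G"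
    using assms(2) unfolding contains_copy_def by auto
  have "inj_on (\<phi> \<circ> \<psi>) (verts H)" using \<phi>(1) \<psi>(1,2) by (meson comp_inj_on inj_on_subset)
  moreover have "(\<phi> \<circ> \<psi>) ` verts H \<subseteq> {..<ramsey_number G}" using \<phi>(2) \<psi>(2) by fastforce
  moreover have "\<forall>e\<in>edges H. c ((\<phi> \<circ> \<psi>) ` e) = i" using \<phi>(3) \<psi>(3) by (metis image_comp)
  ultimately show "\<exists>i. embeds_in_colour c i H {..<ramsey_number G}"
    unfolding embeds_in_colour_def by blast
qed

lemma simple_complete_graph [simp]: "simple_graph (complete_graph n)"
  by (simp add: simple_graph_def complete_graph_def)

lemma embeds_complete_graph_iff:
  "embeds_in_colour c i (complete_graph m) W \<longleftrightarrow> (\<exists>Q\<subseteq>W. mono_clique c i Q \<and> card Q = m \<and> finite Q)"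
proof
  assume "embeds_in_colour c i (complete_graph m) W"
  then obtain \<phi> where \<phi>: "inj_on \<phi> {..<m}" "\<phi> ` {..<m} \<subseteq> W" "\<forall>e\<in>[{..<m}]\<^bsup>2\<^esup>. c (\<phi> ` e) = i"
    by (auto simp: embeds_in_colour_def complete_graph_def)
  have "c {\<phi> u, \<phi> v} = i" if "u < m" "v < m" "u \<noteq> v" for u v
    using \<phi>(3)[rule_format, of "{u, v}"] that by auto
  then have "mono_clique c i (\<phi> ` {..<m})" unfolding mono_clique_def by blast
  then show "\<exists>Q\<subseteq>W. mono_clique c i Q \<and> card Q = m \<and> finite Q"
    using \<phi>(1,2) by (intro exI[of _ "\<phi> ` {..<m}"]) (auto simp: card_image)
next
  assume "\<exists>Q\<subseteq>W. mono_clique c i Q \<and> card Q = m \<and> finite Q"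
  then obtain Q where Q: "Q \<subseteq> W" "mono_clique c i Q" "card Q = m" "finite Q" by auto
  obtain \<phi> where \<phi>: "bij_betw \<phi> {..<m} Q"
    using ex_bij_betw_nat_finite[OF Q(4)] Q(3) by (auto simp: atLeast0LessThan)
  have "c (\<phi> ` e) = i" if e: "e \<in> [{..<m}]\<^bsup>2\<^esup>" for e
  proof -
    obtain u v where "e = {u, v}" "u < m" "v < m" "u \<noteq> v" using e by (auto elim!: nsets2_E)
    then show ?thesis using \<phi> Q(2) by (auto simp: bij_betw_def mono_clique_def inj_on_def)
  qed
  then show "embeds_in_colour c i (complete_graph m) W"
    using \<phi> Q(1) by (auto simp: embeds_in_colour_def complete_graph_def bij_betw_def)
qed

section \<open>A large book whose pages contain a large clique\<close>

text \<open>
  The term with \<open>32 ^ m\<close> in the expansion of \<open>(1 + 32) ^ (m + d)\<close>; the exponents come from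
  \<open>33 ^ 16 \<le> 2 ^ 81\<close>. When \<open>d\<close> is about \<open>m / 81\<close>, the binomial coefficient is at most about
  \<open>2 ^ (m / 8)\<close>, which is far below the exponential lower bound \<open>2 ^ (m / 2)\<close> for Ramsey numbers.
\<close>

lemma binomial_power_bound: "((m + d) choose d) ^ 16 \<le> 2 ^ (m + 81 * d)"
proof -
  let ?B = "(m + d) choose d"
  have "?B * 32 ^ m = (m + d choose m) * 32 ^ m * 1 ^ (m + d - m)"
    by (simp add: binomial_symmetric[of d "m + d"])
  also have "\<dots> \<le> (\<Sum>k\<le>m + d. (m + d choose k) * 32 ^ k * 1 ^ (m + d - k))"
    by (rule member_le_sum) auto
  also have "\<dots> = (32 + 1) ^ (m + d)" by (subst binomial) simp
  finally have "?B * 32 ^ m \<le> 33 ^ (m + d)" by simp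
  then have "(?B * 32 ^ m) ^ 16 \<le> (33 ^ (m + d)) ^ 16" by (rule power_mono) simp
  also have "\<dots> = (33 ^ 16) ^ (m + d)" by (simp only: power_mult[symmetric] mult.commute)
  also have "\<dots> \<le> (2 ^ 81) ^ (m + d)" by (rule power_mono) auto
  also have "\<dots> = 2 ^ (m + 81 * d) * 2 ^ (80 * m)"
    by (simp only: power_mult[symmetric] power_add[symmetric]) (simp add: algebra_simps)
  finally have "(?B * 32 ^ m) ^ 16 \<le> 2 ^ (m + 81 * d) * 2 ^ (80 * m)" .
  moreover have "(?B * 32 ^ m) ^ 16 = ?B ^ 16 * 2 ^ (80 * m)"
  proof -
    have "(32::nat) = 2 ^ 5" by simp
    then have "((32::nat) ^ m) ^ 16 = 2 ^ (5 * m * 16)" by (simp only: power_mult)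
    then show ?thesis by (simp only: power_mult_distrib) (simp add: mult.commute)
  qed
  ultimately show ?thesis by simp
qed

text \<open>
  The set of \<open>cW\<close> vertices left by \<open>large_subset_with_small_cliques\<close> has lost only a factor \<open>4 * B\<close>, where \<open>B\<close>
  is at most about \<open>2 ^ (m / 8)\<close>. Since \<open>cU\<close> is at least both \<open>r \<ge> 2 ^ (m / 2) / 2\<close> and a large power
  of \<open>n\<close>, a geometric mean of the two bounds leaves room for another chase of \<open>k\<close> steps with factor
  \<open>d\<close>, at the end of which the pages exceed both \<open>n\<^sup>2\<close> and the Ramsey number bounded by \<open>B\<close>. The
  geometric mean is taken by comparing fourth powers.
\<close>

lemma remainder_large:
  fixes k m n r cU cW :: nat
  defines "d \<equiv> m div 81 + 1"
  defines "B \<equiv> (m + d) choose d"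
  assumes "1 \<le> m" "m \<le> n" and r: "2 ^ m \<le> 4 * r\<^sup>2"
    and large: "2 ^ 14 * max r (n ^ (2 * k + 4)) \<le> cU"
    and cW: "cU \<le> 4 * (B * cW)"
  shows "d ^ k * (n\<^sup>2 + B) \<le> cW"
proof -
  have B0: "0 < B" by (simp add: B_def)
  have dn: "d \<le> n" using assms(3,4) unfolding d_def by linarith
  have n0: "0 < n" using assms(3,4) by linarith
  have B8: "B ^ 8 \<le> 2 ^ (m + 41)"
  proof -
    have "(B ^ 8)\<^sup>2 = B ^ 16" by (simp flip: power_mult)
    also have "\<dots> \<le> 2 ^ (m + 81 * d)" unfolding B_def by (rule binomial_power_bound)
    also have "\<dots> \<le> 2 ^ ((m + 41) * 2)" by (rule power_increasing) (auto simp: d_def)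
    also have "\<dots> = (2 ^ (m + 41))\<^sup>2" by (rule power_mult)
    finally show ?thesis by (rule power2_le_imp_le) simp
  qed
  have "(8 * B\<^sup>2 * n ^ (k + 2)) ^ 4 = 8 ^ 4 * B ^ 8 * n ^ (4 * k + 8)"
    by (simp add: power_mult_distrib flip: power_mult) (simp add: algebra_simps flip: power_add)
  also have "\<dots> \<le> 8 ^ 4 * 2 ^ (m + 41) * n ^ (4 * k + 8)"
    using B8 by (intro mult_right_mono mult_left_mono) auto
  also have "\<dots> = 2 ^ 53 * 2 ^ m * n ^ (4 * k + 8)" by (simp add: power_add)
  also have "\<dots> \<le> 2 ^ 54 * 2 ^ m * n ^ (4 * k + 8)" by (intro mult_right_mono) auto
  also have "\<dots> \<le> 2 ^ 54 * (4 * r\<^sup>2) * n ^ (4 * k + 8)"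
    using r by (intro mult_right_mono mult_left_mono) auto
  also have "\<dots> = 2 ^ 56 * (r\<^sup>2 * (n ^ (2 * k + 4))\<^sup>2)"
    by (simp add: algebra_simps flip: power_mult)
  also have "\<dots> \<le> 2 ^ 56 * ((max r (n ^ (2 * k + 4)))\<^sup>2 * (max r (n ^ (2 * k + 4)))\<^sup>2)"
    by (intro mult_left_mono mult_mono power_mono) auto
  also have "\<dots> = (2 ^ 14 * max r (n ^ (2 * k + 4))) ^ 4"
    by (simp add: power_mult_distrib flip: power_add)
  also have "\<dots> \<le> cU ^ 4" using large by (rule power_mono) simp
  finally have "8 * B\<^sup>2 * n ^ (k + 2) \<le> cU" by (rule power_le_imp_le_base[of _ 3, simplified]) simp
  moreover have "4 * (B * (d ^ k * (n\<^sup>2 + B))) \<le> 8 * B\<^sup>2 * n ^ (k + 2)"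
  proof -
    have "n\<^sup>2 + B \<le> n\<^sup>2 * B + n\<^sup>2 * B" using n0 B0 by (intro add_mono) auto
    then have "d ^ k * (n\<^sup>2 + B) \<le> n ^ k * (2 * n\<^sup>2 * B)"
      using dn by (intro mult_mono power_mono) auto
    then have "4 * (B * (d ^ k * (n\<^sup>2 + B))) \<le> 4 * (B * (n ^ k * (2 * n\<^sup>2 * B)))" by (intro mult_le_mono2)
    also have "\<dots> = 8 * B\<^sup>2 * n ^ (k + 2)" by (simp add: power_add power2_eq_square)
    finally show ?thesis .
  qed
  ultimately have "B * (d ^ k * (n\<^sup>2 + B)) \<le> B * cW" using cW by linarith
  then show ?thesis using B0 by simp
qed

text \<open>
  Given a book of colour \<open>i\<close> whose pages fill \<open>A\<close>, it remains to find a clique of colour \<open>i\<close> in \<open>A\<close>, or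
  another book of colour \<open>j\<close> inside \<open>A\<close> with a clique of colour \<open>j\<close> in its pages. If \<open>A\<close> contains a
  large book of colour \<open>j\<close>, its pages are joined to spines of both colours, and any monochromatic
  clique in them will do. Otherwise colour \<open>j\<close> is sparse on a large subset. If this has no clique of
  colour \<open>i\<close> of size \<open>m\<close>, then it has a large part \<open>W\<close> with only tiny cliques of colour \<open>i\<close>. Inside \<open>W\<close>
  colour \<open>j\<close> cannot be sparse, which gives a large book of colour \<open>j\<close>, and the Erdos--Szekeres bound
  gives a clique of colour \<open>j\<close> in its pages.
\<close>

lemma extend_book_to_clique:
  fixes c :: "'a set \<Rightarrow> colour"
  assumes "finite A" "i \<noteq> j" "1 \<le> m" "m \<le> n"
    and r: "2 ^ m \<le> 4 * (ramsey_number (complete_graph m))\<^sup>2"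
    and large: "162 ^ k * (2 ^ 14 * max (ramsey_number (complete_graph m)) (n ^ (2 * k + 4))) \<le> card A"
    and X: "book c i X A" "card X = k"
  shows "\<exists>l Y W Q. Y \<subseteq> X \<union> A \<and> W \<subseteq> A \<and> book c l Y W \<and> card Y = k \<and> n \<le> card W \<and>
    Q \<subseteq> W \<and> mono_clique c l Q \<and> card Q = m"
proof -
  let ?r = "ramsey_number (complete_graph m)"
  define M where "M = 2 ^ 14 * max ?r (n ^ (2 * k + 4))"
  have "n \<le> n ^ (2 * k + 4)" using assms(3,4) by (intro self_le_power) auto
  moreover have "2 ^ 14 * n ^ (2 * k + 4) \<le> M" and rM: "2 ^ 14 * ?r \<le> M"
    unfolding M_def by (intro mult_le_mono2 max.cobounded1 max.cobounded2)+
  ultimately have nM: "4 * n \<le> M" "n \<le> M" by simp_all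
  have large': "162 ^ k * M \<le> card A" using large by (simp add: M_def)
  consider Y W where "Y \<subseteq> A" "W \<subseteq> A" "M \<le> card W" "book c j Y W" "card Y = k"
    | U where "U \<subseteq> A" "M \<le> card U" "\<forall>v\<in>U. 162 * card (nbrs c j U v) < card U"
    using large_book_or_sparse[OF assms(1) _ large', of c j] by auto
  then show ?thesis
  proof cases
    case 1
    have "finite W" using 1(2) assms(1) finite_subset by blast
    then obtain l Q where Q: "Q \<subseteq> W" "mono_clique c l Q" "card Q = m"
      using ex_mono_copy[of "complete_graph m" W c] 1(3) rM by (auto simp: embeds_complete_graph_iff)
    have "l = i \<or> l = j" using colour_neq_iff[OF assms(2)] by blast
    then show ?thesis
    proof
      assume "l = i"
      then show ?thesis using Q X book_antimono[OF X(1) 1(2)] 1 nM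
        by (intro exI[of _ i] exI[of _ X] exI[of _ W] exI[of _ Q]) auto
    next
      assume "l = j"
      then show ?thesis using Q 1 nM
        by (intro exI[of _ j] exI[of _ Y] exI[of _ W] exI[of _ Q]) auto
    qed
  next
    case 2
    have finU: "finite U" using 2(1) assms(1) finite_subset by blast
    show ?thesis
    proof (cases "\<exists>J. J \<subseteq> U \<and> mono_clique c i J \<and> card J = m")
      case True
      then obtain J where "J \<subseteq> U" "mono_clique c i J" "card J = m" by blast
      then show ?thesis using X book_antimono[OF X(1) 2(1)] 2 nM
        by (intro exI[of _ i] exI[of _ X] exI[of _ U] exI[of _ J]) auto
    next
      case False
      define d where "d = m div 81 + 1"
      let ?B = "(m + d) choose d"
      have "m \<le> 81 * d" using dividend_less_times_div[of 81 m] by (simp add: d_def)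
      moreover have "4 * m \<le> card U" using nM 2(2) assms(4) by linarith
      moreover have "2 * 81 * card (nbrs c j U v) < card U" if "v \<in> U" for v using 2(3) that by simp
      ultimately obtain W where W: "W \<subseteq> U" "\<nexists>J. J \<subseteq> W \<and> mono_clique c i J \<and> card J = d"
        "card U \<le> 4 * (?B * card W)"
        using large_subset_with_small_cliques[OF finU assms(2), of 81 c m d] False by blast
      have finW: "finite W" using W(1) finU finite_subset by blast
      have "2 ^ 14 * max ?r (n ^ (2 * k + 4)) \<le> card U" using 2(2) by (simp add: M_def)
      then have cW: "d ^ k * (n\<^sup>2 + ?B) \<le> card W"
        using remainder_large[OF assms(3,4) r] W(3) unfolding d_def by blast
      have "1 \<le> d" by (simp add: d_def)
      then consider Y V where "Y \<subseteq> W" "V \<subseteq> W" "n\<^sup>2 + ?B \<le> card V" "book c j Y V" "card Y = k"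
        | V where "V \<subseteq> W" "n\<^sup>2 + ?B \<le> card V" "\<forall>v\<in>V. d * card (nbrs c j V v) < card V"
        using large_book_or_sparse[OF finW _ cW, of c j] by blast
      then show ?thesis
      proof cases
        case Y: 1
        have "finite V" using Y(2) finW finite_subset by blast
        then obtain J where "J \<subseteq> V" "mono_clique c j J" "card J = m"
          using erdos_szekeres_clique[OF _ assms(2), of V m d c] Y(2,3) W(2) by (meson add_leE order_trans)
        moreover have "n \<le> card V" using Y(3) self_le_power[of n 2] assms(3,4) by auto
        ultimately show ?thesis using Y W(1) 2(1)
          by (intro exI[of _ j] exI[of _ Y] exI[of _ V] exI[of _ J]) auto
      next
        case V: 2
        have "d \<le> n" using assms(3,4) unfolding d_def by linarith
        then have "d * d \<le> n\<^sup>2" unfolding power2_eq_square by (rule mult_le_mono) fact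
        moreover have "0 < ?B" by simp
        ultimately have "d * d < card V" using V(2) by linarith
        have "finite V" using V(1) finW finite_subset by blast
        then have "\<exists>J\<subseteq>V. mono_clique c i J \<and> card J = d"
          by (rule clique_in_sparse_complement[OF _ assms(2) _ \<open>d * d < card V\<close>]) (use V(3) in blast)
        then obtain J where J: "J \<subseteq> V" "mono_clique c i J" "card J = d" by blast
        moreover have "J \<subseteq> W" using J(1) V(1) by (rule subset_trans)
        ultimately have False using W(2) by blast
        then show ?thesis ..
      qed
    qed
  qed
qed

text \<open>
  As \<open>k \<ge> 1\<close> in the applications, spine and clique together have at least \<open>m + 1\<close> vertices. This is
  how the Ramsey number of the clique on \<open>m + 1\<close> vertices, with further vertices attached to \<open>k\<close> of
  them, is bounded by that of the clique on \<open>m\<close> vertices.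
\<close>

lemma ex_book_with_clique:
  fixes c :: "'a set \<Rightarrow> colour"
  assumes "finite A" "1 \<le> m" "m \<le> n"
    and r: "2 ^ m \<le> 4 * (ramsey_number (complete_graph m))\<^sup>2"
    and large: "4 ^ k * (162 ^ k * (2 ^ 14 * max (ramsey_number (complete_graph m)) (n ^ (2 * k + 4)))) \<le> card A"
  shows "\<exists>l Y W Q. Y \<subseteq> A \<and> W \<subseteq> A \<and> book c l Y W \<and> card Y = k \<and> n \<le> card W \<and>
    Q \<subseteq> W \<and> mono_clique c l Q \<and> card Q = m"
proof -
  define M where "M = 162 ^ k * (2 ^ 14 * max (ramsey_number (complete_graph m)) (n ^ (2 * k + 4)))"
  have "1 \<le> M"
    using ramsey_number_arrows(1)[OF simple_complete_graph, of m] by (simp add: M_def less_max_iff_disj Suc_le_eq)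
  moreover have "2 ^ (k + k) * M \<le> card A"
  proof -
    have "(4::nat) ^ k = 2 ^ (k + k)" by (simp add: power_add flip: power_mult_distrib)
    then show ?thesis using large by (simp add: M_def)
  qed
  ultimately obtain X W where XW: "X \<subseteq> A" "W \<subseteq> A" "M \<le> card W" "card X = k"
    and "book c Red X W \<or> book c Blue X W"
    using ex_large_book[OF assms(1) colour.distinct(1), of M k k c] by blast
  then obtain i j where "book c i X W" "i \<noteq> j" by (metis colour.distinct(1))
  moreover have "finite W" using XW(2) assms(1) finite_subset by blast
  ultimately obtain l Y V Q where *: "Y \<subseteq> X \<union> W" "V \<subseteq> W" "book c l Y V" "card Y = k" "n \<le> card V"
    "Q \<subseteq> V" "mono_clique c l Q" "card Q = m"
    using extend_book_to_clique[OF _ _ assms(2,3) r, of W i j k c X] XW(3,4) unfolding M_def by blast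
  then have "Y \<subseteq> A" "V \<subseteq> A" using XW(1,2) by auto
  then show ?thesis using * by blast
qed

section \<open>The two families of k-connected graphs\<close>

text \<open>
  The clique on the first \<open>m\<close> vertices controls the Ramsey number, and joining every vertex to the
  first \<open>k\<close> makes the graph \<open>k\<close>-connected.
\<close>

definition planted_clique :: "nat \<Rightarrow> nat \<Rightarrow> nat \<Rightarrow> nat sgraph" where
  "planted_clique k m n =
     \<lparr>verts = {..<n}, edges = {{u, v} | u v. u < v \<and> v < n \<and> (v < m \<or> u < k)}\<rparr>"

definition biclique :: "nat \<Rightarrow> nat \<Rightarrow> nat sgraph" where
  "biclique s n = \<lparr>verts = {..<n}, edges = {{u, v} | u v. u < s \<and> s \<le> v \<and> v < n}\<rparr>"

lemma simple_planted_clique [simp]: "simple_graph (planted_clique k m n)"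
  by (auto simp: simple_graph_def planted_clique_def)

lemma simple_biclique [simp]: "simple_graph (biclique s n)"
  by (auto simp: simple_graph_def biclique_def)

text \<open>
  Reachability is symmetric, so one vertex that can be reached from all others is enough. For
  \<open>planted_clique\<close> this is one of the first \<open>k\<close> vertices that has not been deleted.
\<close>

lemma k_connectedI:
  assumes "\<And>S. S \<subseteq> verts G \<Longrightarrow> card S < k \<Longrightarrow> verts G - S \<noteq> {} \<Longrightarrow>
      \<exists>w. \<forall>u\<in>verts G - S. (u, w) \<in> (adjacency (delete_verts G S))\<^sup>*"
  shows "k_connected k G"
proof -
  have "sym (adjacency (delete_verts G S))" for S
    by (auto simp: sym_def adjacency_def insert_commute)
  then have s: "sym ((adjacency (delete_verts G S))\<^sup>*)" for S by (rule sym_rtrancl)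
  show ?thesis
    unfolding k_connected_def disconnected_def
  proof (intro allI impI notI, elim bexE conjE)
    fix S u v
    assume S: "S \<subseteq> verts G" "card S < k"
      and u: "u \<in> verts (delete_verts G S)" and v: "v \<in> verts (delete_verts G S)"
      and n: "(u, v) \<notin> (adjacency (delete_verts G S))\<^sup>*"
    have uv: "u \<in> verts G - S" "v \<in> verts G - S" using u v by (auto simp: delete_verts_def)
    then obtain w where "(u, w) \<in> (adjacency (delete_verts G S))\<^sup>*" "(v, w) \<in> (adjacency (delete_verts G S))\<^sup>*"
      using assms[OF S] by blast
    then show False using n s[of S] by (meson rtrancl_trans symD)
  qed
qed

lemma ex_not_in_small:
  assumes "finite A" "card S < k" "k \<le> card A" "finite S"
  obtains w where "w \<in> A" "w \<notin> S"
  using assms by (metis card_mono leD le_trans subsetI)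

lemma k_connected_complete_graph: "k_connected k (complete_graph n)"
proof (rule k_connectedI)
  fix S assume "verts (complete_graph n) - S \<noteq> {}"
  then obtain w where w: "w \<in> verts (complete_graph n) - S" by blast
  have "(u, w) \<in> (adjacency (delete_verts (complete_graph n) S))\<^sup>*"
    if "u \<in> verts (complete_graph n) - S" for u
    using that w by (cases "u = w")
      (auto intro!: r_into_rtrancl simp: adjacency_def delete_verts_def complete_graph_def)
  then show "\<exists>w. \<forall>u\<in>verts (complete_graph n) - S. (u, w) \<in> (adjacency (delete_verts (complete_graph n) S))\<^sup>*"
    by blast
qed

lemma k_connected_planted_clique:
  assumes "k \<le> n"
  shows "k_connected k (planted_clique k m n)"
proof (rule k_connectedI)
  let ?G = "planted_clique k m n"
  fix S assume S: "S \<subseteq> verts ?G" "card S < k"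
  have "finite S" using S(1) by (auto simp: planted_clique_def intro: finite_subset)
  then obtain w where w: "w < k" "w \<notin> S"
    using ex_not_in_small[of "{..<k}" S k] S(2) by auto
  have "(u, w) \<in> (adjacency (delete_verts ?G S))\<^sup>*" if u: "u \<in> verts ?G - S" for u
  proof (cases "u = w")
    case False
    have "{u, w} \<in> edges ?G"
    proof (cases "u < w")
      case True
      then show ?thesis using w(1) assms by (force simp: planted_clique_def)
    next
      case F: False
      then have "w < u" using False by simp
      then show ?thesis using w(1) u by (force simp: planted_clique_def)
    qed
    then show ?thesis
      using u w by (intro r_into_rtrancl) (auto simp: adjacency_def delete_verts_def)
  qed simp
  then show "\<exists>w. \<forall>u\<in>verts ?G - S. (u, w) \<in> (adjacency (delete_verts ?G S))\<^sup>*" by blast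
qed

lemma k_connected_biclique:
  assumes "k \<le> s" "s + k \<le> n"
  shows "k_connected k (biclique s n)"
proof (rule k_connectedI)
  let ?G = "biclique s n"
  fix S assume S: "S \<subseteq> verts ?G" "card S < k"
  have finS: "finite S" using S(1) by (auto simp: biclique_def intro: finite_subset)
  obtain a where a: "a < s" "a \<notin> S"
    using ex_not_in_small[of "{..<s}" S k] S(2) finS assms by auto
  have "k \<le> card {s..<n}" using assms(2) by simp
  then obtain b where b: "s \<le> b" "b < n" "b \<notin> S"
    using ex_not_in_small[OF _ S(2) _ finS, of "{s..<n}"] by auto
  let ?R = "adjacency (delete_verts ?G S)"
  have adj: "(x, y) \<in> ?R" "(y, x) \<in> ?R"
    if "x < s" "s \<le> y" "y < n" "x \<notin> S" "y \<notin> S" for x y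
    using that by (auto simp: adjacency_def delete_verts_def biclique_def insert_commute)
  have "(u, a) \<in> ?R\<^sup>*" if "u \<in> verts ?G - S" for u
  proof (cases "u < s")
    case True
    then have "(u, b) \<in> ?R" "(b, a) \<in> ?R" using that a b by (auto intro: adj)
    then show ?thesis by (meson r_into_rtrancl rtrancl_trans)
  next
    case False
    then have "(u, a) \<in> ?R" using adj(2)[of a u] that a by (simp add: biclique_def)
    then show ?thesis by blast
  qed
  then show "\<exists>w. \<forall>u\<in>verts ?G - S. (u, w) \<in> ?R\<^sup>*" by blast
qed

text \<open>
  The spine receives the first \<open>k\<close> vertices, \<open>Q\<close> the rest of the planted clique, and the remaining
  pages all other vertices.
\<close>

lemma embeds_planted_clique:
  assumes "finite X" "finite W" "book c i X W" "card X = k" "n \<le> card W"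
    "Q \<subseteq> W" "mono_clique c i Q" "card Q = m" "k \<le> Suc m" "Suc m \<le> n" "1 \<le> k"
  shows "embeds_in_colour c i (planted_clique k (Suc m) n) (X \<union> W)"
proof -
  have "Suc m - k \<le> card Q" using assms(8,11) by simp
  then obtain Q' where Q': "Q' \<subseteq> Q" "card Q' = Suc m - k" "finite Q'"
    by (metis obtain_subset_with_card_n)
  have "n - Suc m \<le> card (W - Q')"
    using diff_card_le_card_Diff[OF Q'(3), of W] Q'(2) assms(5,10,11) by linarith
  then obtain R where R: "R \<subseteq> W - Q'" "card R = n - Suc m" "finite R"
    by (metis obtain_subset_with_card_n)
  obtain f where f: "bij_betw f {..<k} X"
    using finite_same_card_bij[of "{..<k}" X] assms(1,4) by auto
  obtain g where g: "bij_betw g {k..<Suc m} Q'"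
    using finite_same_card_bij[of "{k..<Suc m}" Q'] Q' by auto
  obtain h where h: "bij_betw h {Suc m..<n} R"
    using finite_same_card_bij[of "{Suc m..<n}" R] R by auto
  define \<phi> where "\<phi> x = (if x < k then f x else if x < Suc m then g x else h x)" for x
  have dXW: "X \<inter> W = {}" using book_disjoint[OF assms(3)] .
  have bf: "bij_betw \<phi> {..<k} X" using f by (subst bij_betw_cong[of _ _ f]) (auto simp: \<phi>_def)
  have bg: "bij_betw \<phi> {k..<Suc m} Q'" using g by (subst bij_betw_cong[of _ _ g]) (auto simp: \<phi>_def)
  have bh: "bij_betw \<phi> {Suc m..<n} R"
    using h assms(9) by (subst bij_betw_cong[of _ _ h]) (auto simp: \<phi>_def)
  have "bij_betw \<phi> ({..<k} \<union> ({k..<Suc m} \<union> {Suc m..<n})) (X \<union> (Q' \<union> R))"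
    using bf bg bh dXW R(1) Q'(1) assms(6) by (intro bij_betw_combine) auto
  moreover have "{..<k} \<union> ({k..<Suc m} \<union> {Suc m..<n}) = {..<n}" using assms(9,10) by auto
  ultimately have bij: "bij_betw \<phi> {..<n} (X \<union> (Q' \<union> R))" by simp
  have inX: "\<phi> u \<in> X" if "u < k" for u using bf that by (auto simp: bij_betw_def)
  have inQ: "\<phi> u \<in> Q'" if "k \<le> u" "u < Suc m" for u using bg that by (auto simp: bij_betw_def)
  have inR: "\<phi> u \<in> R" if "Suc m \<le> u" "u < n" for u using bh that by (auto simp: bij_betw_def)
  have inW: "\<phi> u \<in> W" if "k \<le> u" "u < n" for u
    using inQ[of u] inR[of u] that Q'(1) R(1) assms(6) by (meson DiffD1 not_less subsetD)
  have "c {\<phi> u, \<phi> v} = i" if uv: "u < v" "v < n" "v < Suc m \<or> u < k" for u v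
  proof -
    have neq: "\<phi> u \<noteq> \<phi> v" using bij uv by (auto simp: bij_betw_def inj_on_def)
    consider "v < k" | "u < k" "k \<le> v" | "k \<le> u" "v < Suc m" using uv by linarith
    then show ?thesis
    proof cases
      case 1
      then show ?thesis using inX[of u] inX[of v] uv neq assms(3) by (auto simp: book_def mono_clique_def)
    next
      case 2
      then show ?thesis using book_edge[OF assms(3) inX inW] uv by blast
    next
      case 3
      then show ?thesis using inQ[of u] inQ[of v] uv neq Q'(1) assms(7) by (auto simp: mono_clique_def)
    qed
  qed
  moreover have "X \<union> (Q' \<union> R) \<subseteq> X \<union> W" using Q'(1) R(1) assms(6) by auto
  ultimately show ?thesis
    using bij unfolding embeds_in_colour_def planted_clique_def bij_betw_def
    by (intro exI[of _ \<phi>]) auto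
qed

section \<open>Lower bounds by the union bound\<close>

text \<open>
  A colouring is identified with its set of red elements. A fraction \<open>2 / 2 ^ e\<close> of them is
  constant on a given set of size \<open>e\<close>.
\<close>

lemma ex_colouring_avoiding:
  fixes F :: "'p \<Rightarrow> 'e set"
  assumes "finite E" "finite P" "\<And>p. p \<in> P \<Longrightarrow> F p \<subseteq> E" "\<And>p. p \<in> P \<Longrightarrow> card (F p) = e"
    and few: "2 * card P < 2 ^ e"
  shows "\<exists>c :: 'e \<Rightarrow> colour. \<forall>p\<in>P. \<forall>i. \<exists>x\<in>F p. c x \<noteq> i"
proof -
  define bad where "bad p = {A. F p \<subseteq> A \<and> A \<subseteq> E} \<union> {A. A \<subseteq> E - F p}" for p
  have cbad: "card (bad p) * 2 ^ e \<le> 2 * 2 ^ card E" if p: "p \<in> P" for p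
  proof -
    have finF: "finite (F p)" using assms(1,3) p finite_subset by blast
    have eE: "e \<le> card E" using assms(1,3,4) p card_mono by metis
    have "{A. F p \<subseteq> A \<and> A \<subseteq> E} \<subseteq> (\<lambda>A. A \<union> F p) ` Pow (E - F p)"
    proof
      fix A assume "A \<in> {A. F p \<subseteq> A \<and> A \<subseteq> E}"
      then show "A \<in> (\<lambda>A. A \<union> F p) ` Pow (E - F p)" by (intro image_eqI[of _ _ "A - F p"]) auto
    qed
    then have "card {A. F p \<subseteq> A \<and> A \<subseteq> E} \<le> card (Pow (E - F p))"
      using assms(1) by (intro surj_card_le) auto
    moreover have "{A. A \<subseteq> E - F p} = Pow (E - F p)" by auto
    ultimately have "card (bad p) \<le> 2 * card (Pow (E - F p))"
      unfolding bad_def using card_Un_le[of "{A. F p \<subseteq> A \<and> A \<subseteq> E}" "{A. A \<subseteq> E - F p}"] by simp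
    also have "\<dots> = 2 * 2 ^ (card E - e)"
      using assms(1,3,4) p finF by (simp add: card_Pow card_Diff_subset)
    finally have "card (bad p) * 2 ^ e \<le> 2 * 2 ^ (card E - e) * 2 ^ e" by (rule mult_right_mono) simp
    also have "\<dots> = 2 * 2 ^ card E" using eE by (simp flip: power_add)
    finally show ?thesis .
  qed
  have "card (\<Union>p\<in>P. bad p) * 2 ^ e \<le> (\<Sum>p\<in>P. card (bad p)) * 2 ^ e"
    by (intro mult_right_mono card_UN_le assms) auto
  also have "\<dots> \<le> (\<Sum>p\<in>P. 2 * 2 ^ card E)"
    unfolding sum_distrib_right by (intro sum_mono cbad)
  also have "\<dots> = 2 * card P * 2 ^ card E" by simp
  also have "\<dots> < 2 ^ e * 2 ^ card E" using few by (intro mult_strict_right_mono) auto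
  finally have "card (\<Union>p\<in>P. bad p) < card (Pow E)" using assms(1) by (simp add: card_Pow)
  then have "\<not> Pow E \<subseteq> (\<Union>p\<in>P. bad p)"
    using card_mono[of "\<Union>p\<in>P. bad p" "Pow E"] assms(1,2) unfolding bad_def by (auto simp: not_le)
  then obtain A where A: "A \<subseteq> E" "\<And>p. p \<in> P \<Longrightarrow> A \<notin> bad p" by blast
  have "\<exists>x\<in>F p. (if x \<in> A then Red else Blue) \<noteq> i" if p: "p \<in> P" for p i
  proof -
    have "\<exists>x\<in>F p. x \<notin> A" "\<exists>x\<in>F p. x \<in> A" using A(1) A(2)[OF p] unfolding bad_def by auto
    then show ?thesis by (cases i) auto
  qed
  then show ?thesis by (intro exI[of _ "\<lambda>x. if x \<in> A then Red else Blue"]) blast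
qed

lemma ramsey_number_complete_graph_gt:
  assumes "2 * (N choose m) < 2 ^ (m choose 2)"
  shows "N < ramsey_number (complete_graph m)"
proof -
  obtain c :: "nat set \<Rightarrow> colour" where c: "\<forall>Q\<in>[{..<N}]\<^bsup>m\<^esup>. \<forall>i. \<exists>x\<in>[Q]\<^bsup>2\<^esup>. c x \<noteq> i"
  proof -
    have Q: "Q \<subseteq> {..<N}" "card Q = m" if "Q \<in> [{..<N}]\<^bsup>m\<^esup>" for Q
      using that by (auto simp: nsets_def)
    have sub: "[Q]\<^bsup>2\<^esup> \<subseteq> [{..<N}]\<^bsup>2\<^esup>" and card: "card ([Q]\<^bsup>2\<^esup>) = m choose 2"
      if "Q \<in> [{..<N}]\<^bsup>m\<^esup>" for Q
      using Q[OF that] by (simp_all add: nsets_mono)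
    have few: "2 * card ([{..<N}]\<^bsup>m\<^esup>) < 2 ^ (m choose 2)" using assms by simp
    show thesis
      using that ex_colouring_avoiding[where F = "\<lambda>Q. [Q]\<^bsup>2\<^esup>", OF _ _ sub card few]
      by (auto simp: finite_imp_finite_nsets)
  qed
  have "\<not> embeds_in_colour c i (complete_graph m) {..<N}" for i
  proof
    assume "embeds_in_colour c i (complete_graph m) {..<N}"
    then obtain Q where Q: "Q \<in> [{..<N}]\<^bsup>m\<^esup>" "mono_clique c i Q"
      by (auto simp: embeds_complete_graph_iff nsets_def)
    have "c x = i" if "x \<in> [Q]\<^bsup>2\<^esup>" for x
      using that Q(2) by (auto elim!: nsets2_E simp: mono_clique_def)
    then show False using c Q(1) by blast
  qed
  then show ?thesis by (rule ramsey_number_gtI[OF simple_complete_graph])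
qed

text \<open>
  The lower bound \<open>2 ^ (m / 2) / 2\<close> of Erdos, squared to avoid half-integral exponents.
\<close>

lemma ramsey_number_complete_graph_lower: "2 ^ m \<le> 4 * (ramsey_number (complete_graph m))\<^sup>2"
proof (cases "m \<le> 2")
  case True
  then have "(2::nat) ^ m \<le> 2 ^ 2" by (intro power_increasing) auto
  also have "\<dots> \<le> 4 * (ramsey_number (complete_graph m))\<^sup>2"
    using ramsey_number_arrows(1)[OF simple_complete_graph, of m] by simp
  finally show ?thesis .
next
  case False
  define h where "h = (m - 1) div 2"
  have hm: "2 * h \<le> m - 1" "m \<le> 2 * (h + 1)" using False by (auto simp: h_def)
  have "(2::nat) < fact m" using False fact_mono[of 3 m, where 'a = nat] by (simp add: fact_numeral)
  have "h * m \<le> m choose 2"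
  proof -
    have "2 * (h * m) \<le> m * (m - 1)" using mult_le_mono2[OF hm(1), of m] by (simp add: algebra_simps)
    then show ?thesis unfolding choose_two by linarith
  qed
  have "2 * (2 ^ h choose m) < 2 ^ (m choose 2)"
  proof (cases "2 ^ h choose m = 0")
    case nz: False
    have "2 * (2 ^ h choose m) < fact m * (2 ^ h choose m)"
      using nz \<open>2 < fact m\<close> by (intro mult_strict_right_mono) auto
    also have "\<dots> \<le> (2 ^ h) ^ m" using binomial_fact_pow[of "2 ^ h" m] by (simp add: mult.commute)
    also have "\<dots> \<le> 2 ^ (m choose 2)"
      using \<open>h * m \<le> m choose 2\<close> by (simp flip: power_mult)
    finally show ?thesis .
  qed (simp add: binomial_eq_0)
  then have "2 ^ h \<le> ramsey_number (complete_graph m)"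
    using ramsey_number_complete_graph_gt less_imp_le by blast
  then have "(2 ^ h)\<^sup>2 \<le> (ramsey_number (complete_graph m))\<^sup>2" by (rule power_mono) simp
  moreover have "(2::nat) ^ m \<le> 2 ^ (2 * (h + 1))" using hm(2) by (rule power_increasing) simp
  moreover have "(2::nat) ^ (2 * (h + 1)) = 4 * (2 ^ h)\<^sup>2" 
    by (simp add: power_mult power2_eq_square flip: power_mult_distrib)
  ultimately show ?thesis by linarith
qed

lemma ramsey_number_biclique_gt:
  assumes "s \<le> n" "2 * ((N choose s) * (N choose (n - s))) < 2 ^ (s * (n - s))"
  shows "N < ramsey_number (biclique s n)"
proof -
  define P where "P = {(S, T). S \<in> [{..<N}]\<^bsup>s\<^esup> \<and> T \<in> nsets {..<N} (n - s) \<and> S \<inter> T = {}}"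
  define F where "F = (\<lambda>(S, T). (\<lambda>(u, v). {u, v}) ` (S \<times> T) :: nat set set)"
  have sub: "P \<subseteq> [{..<N}]\<^bsup>s\<^esup> \<times> nsets {..<N} (n - s)" by (auto simp: P_def)
  have fin: "finite ([{..<N}]\<^bsup>s\<^esup> \<times> nsets {..<N} (n - s))" by (simp add: finite_imp_finite_nsets)
  have "card P \<le> (N choose s) * (N choose (n - s))"
    using card_mono[OF fin sub] by (simp add: card_cartesian_product)
  then have few: "2 * card P < 2 ^ (s * (n - s))" using assms(2) by linarith
  have card_F: "card (F p) = s * (n - s)" if "p \<in> P" for p
  proof -
    obtain S T where p: "p = (S, T)" by (cases p)
    have "inj_on (\<lambda>(u, v). {u, v}) (S \<times> T)"
      using that by (auto simp: P_def p inj_on_def doubleton_eq_iff)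
    then show ?thesis using that by (auto simp: F_def p card_image P_def nsets_def card_cartesian_product)
  qed
  have "F p \<subseteq> [{..<N}]\<^bsup>2\<^esup>" if "p \<in> P" for p
  proof -
    obtain S T where p: "p = (S, T)" by (cases p)
    have "S \<subseteq> {..<N}" "T \<subseteq> {..<N}" "S \<inter> T = {}" using that by (auto simp: P_def p nsets_def)
    then show ?thesis by (auto simp: F_def p)
  qed
  then obtain c :: "nat set \<Rightarrow> colour" where c: "\<forall>p\<in>P. \<forall>i. \<exists>x\<in>F p. c x \<noteq> i"
    using ex_colouring_avoiding[of "[{..<N}]\<^bsup>2\<^esup>" P F "s * (n - s)"] few card_F finite_subset[OF sub fin]
    by (auto simp: finite_imp_finite_nsets)
  have "\<not> embeds_in_colour c i (biclique s n) {..<N}" for i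
  proof
    assume "embeds_in_colour c i (biclique s n) {..<N}"
    then obtain \<phi> where \<phi>: "inj_on \<phi> {..<n}" "\<phi> ` {..<n} \<subseteq> {..<N}"
      and e: "\<forall>e\<in>edges (biclique s n). c (\<phi> ` e) = i"
      by (auto simp: embeds_in_colour_def biclique_def)
    have col: "c {\<phi> u, \<phi> v} = i" if "u < s" "s \<le> v" "v < n" for u v
      using e[rule_format, of "{u, v}"] that by (auto simp: biclique_def)
    let ?S = "\<phi> ` {..<s}" and ?T = "\<phi> ` {s..<n}"
    have sub: "{..<s} \<subseteq> {..<n}" "{s..<n} \<subseteq> {..<n}" using assms(1) by auto
    have "inj_on \<phi> {..<s}" "inj_on \<phi> {s..<n}" using sub by (auto intro: inj_on_subset[OF \<phi>(1)])
    then have "card ?S = s" "card ?T = n - s" by (auto simp: card_image)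
    moreover have "?S \<inter> ?T = {}"
      using inj_on_image_Int[OF \<phi>(1) sub] by (simp add: ivl_disj_int_one(2))
    moreover have "?S \<subseteq> {..<N}" "?T \<subseteq> {..<N}" 
      using order_trans[OF image_mono[OF sub(1)] \<phi>(2)] order_trans[OF image_mono[OF sub(2)] \<phi>(2)] .
    ultimately have "(?S, ?T) \<in> P" by (auto simp: P_def nsets_def)
    moreover have "c x = i" if "x \<in> F (?S, ?T)" for x using that col by (auto simp: F_def)
    ultimately show False using c by blast
  qed
  then show ?thesis by (rule ramsey_number_gtI[OF simple_biclique])
qed

text \<open>
  By \<open>t ^ t * t! \<le> (2 * t)!\<close> and the bound \<open>4 ^ t\<close> for the central binomial coefficient.
\<close>

lemma self_power_le_fact: "t ^ t \<le> 4 ^ t * fact t" for t :: nat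
proof -
  have "t ^ l * fact t \<le> (fact (t + l) :: nat)" for l
  proof (induction l)
    case (Suc l)
    have "t * (t ^ l * fact t) \<le> Suc (t + l) * fact (t + l)"
      by (rule mult_le_mono) (use Suc in auto)
    then show ?case by (simp add: mult.assoc)
  qed simp
  then have "t ^ t * fact t \<le> (fact (2 * t) :: nat)" by (simp add: mult_2)
  also have "\<dots> = fact t * fact t * ((2 * t) choose t)"
    using binomial_fact_lemma[of t "2 * t"] by simp
  also have "\<dots> \<le> fact t * fact t * 2 ^ (2 * t)"
    by (intro mult_left_mono binomial_le_pow2) simp
  also have "(2::nat) ^ (2 * t) = 4 ^ t" by (simp add: power_mult)
  finally have "fact t * t ^ t \<le> fact t * (4 ^ t * fact t :: nat)"
    by (simp add: algebra_simps)
  then show ?thesis by simp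
qed

text \<open>
  The number of choices for the large side, at most \<open>(4 * N / t) ^ t\<close>, is beaten by \<open>2 ^ (s * t)\<close>
  with a factor \<open>4 ^ t\<close> to spare if \<open>N = 2 ^ s * t / 16\<close>. When \<open>s\<close> is of order \<open>log n\<close>, the small side
  has only \<open>N ^ s\<close> choices, and these are fewer than \<open>4 ^ t\<close>.
\<close>

lemma ramsey_number_biclique_lower:
  assumes "2 * s \<le> n" "n \<le> 2 ^ l" "s * (s + l) + 1 < n"
  shows "2 ^ s * n < 32 * ramsey_number (biclique s n)"
proof -
  define t where "t = n - s"
  define N where "N = 2 ^ s * t div 16"
  have t: "n \<le> 2 * t" "s \<le> n" "t \<le> n" using assms(1) by (auto simp: t_def)
  have N16: "16 * N \<le> 2 ^ s * t" by (simp add: N_def)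
  have "(N choose t) * 4 ^ t \<le> 2 ^ (s * t)"
  proof -
    have "((N choose t) * 4 ^ t) * (4 ^ t * fact t) = ((N choose t) * fact t) * 16 ^ t"
      by (simp add: algebra_simps flip: power_mult_distrib)
    also have "\<dots> \<le> N ^ t * 16 ^ t" by (intro mult_right_mono binomial_fact_pow) simp
    also have "\<dots> = (16 * N) ^ t" by (simp add: power_mult_distrib)
    also have "\<dots> \<le> (2 ^ s * t) ^ t" using N16 by (rule power_mono) simp
    also have "\<dots> = 2 ^ (s * t) * t ^ t" by (simp add: power_mult_distrib power_mult)
    also have "\<dots> \<le> 2 ^ (s * t) * (4 ^ t * fact t)" by (intro mult_left_mono self_power_le_fact) simp
    finally show ?thesis by simp
  qed
  moreover have "2 * (N choose s) < 4 ^ t"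
  proof -
    have "N \<le> 2 ^ s * n" using N16 t(3) mult_le_mono2[OF t(3), of "2 ^ s"] by linarith
    also have "\<dots> \<le> 2 ^ (s + l)" using assms(2) by (simp add: power_add)
    finally have "N ^ s \<le> (2 ^ (s + l)) ^ s" by (rule power_mono) simp
    moreover have "N choose s \<le> N ^ s"
      by (cases "s \<le> N") (simp_all add: binomial_le_pow binomial_eq_0)
    ultimately have "2 * (N choose s) \<le> 2 ^ (s * (s + l) + 1)"
      by (simp add: mult.commute flip: power_mult)
    also have "\<dots> < 2 ^ (2 * t)" using assms(3) t(1) by (intro power_strict_increasing) auto
    finally show ?thesis by (simp add: power_mult)
  qed
  ultimately have "2 * ((N choose s) * (N choose t)) < 2 ^ (s * t)"
  proof (cases "N choose t = 0")
    case False
    have "2 * (N choose s) * (N choose t) < 4 ^ t * (N choose t)"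
      using \<open>2 * (N choose s) < 4 ^ t\<close> False by (intro mult_strict_right_mono) auto
    also have "\<dots> \<le> 2 ^ (s * t)" using \<open>(N choose t) * 4 ^ t \<le> 2 ^ (s * t)\<close> by (simp add: mult.commute)
    finally show ?thesis by (simp add: mult.assoc)
  qed (simp add: binomial_eq_0)
  then have N_r: "Suc N \<le> ramsey_number (biclique s n)"
    using ramsey_number_biclique_gt[OF t(2), of N] by (simp add: t_def)
  have "2 ^ s * n \<le> 2 * (2 ^ s * t)"
    using mult_le_mono2[OF t(1), of "2 ^ s"] by (simp add: mult.left_commute)
  also have "\<dots> < 2 * (16 * Suc N)"
    using dividend_less_times_div[of 16 "2 ^ s * t"] by (simp add: N_def)
  also have "\<dots> \<le> 32 * ramsey_number (biclique s n)" using N_r by simp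
  finally show ?thesis .
qed

section \<open>The upper bound for complete bipartite graphs\<close>

text \<open>
  The vertices of \<open>S\<close> are chosen greedily: among the at most \<open>card V\<close> remaining vertices, an average
  one is adjacent to a fraction \<open>(D - s) / card V\<close> of the current set \<open>T'\<close>.
\<close>

lemma ex_large_joint_nbhd:
  assumes "finite V" "T \<subseteq> V" "D \<le> card V" "\<And>v. v \<in> T \<Longrightarrow> D \<le> card (nbrs c i V v)"
  shows "s \<le> D \<Longrightarrow> \<exists>S T'. S \<subseteq> V \<and> card S = s \<and> T' \<subseteq> T \<and> (\<forall>v\<in>T'. S \<subseteq> nbrs c i V v) \<and>
    card T * (D - s) ^ s \<le> card T' * card V ^ s"
proof -
  assume "s \<le> D"
  have "\<exists>S T'. S \<subseteq> V \<and> card S = l \<and> T' \<subseteq> T \<and> (\<forall>v\<in>T'. S \<subseteq> nbrs c i V v) \<and>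
    card T * (D - s) ^ l \<le> card T' * card V ^ l" if "l \<le> s" for l
    using that
  proof (induction l)
    case 0
    then show ?case by (intro exI[of _ "{}"] exI[of _ T]) auto
  next
    case (Suc l)
    then obtain S T' where S: "S \<subseteq> V" "card S = l" "T' \<subseteq> T" "\<forall>v\<in>T'. S \<subseteq> nbrs c i V v"
      "card T * (D - s) ^ l \<le> card T' * card V ^ l" by auto
    have finS: "finite S" and finT: "finite T'"
      using S(1,3) assms(1,2) by (auto intro: finite_subset)
    define N where "N x = {v \<in> T'. x \<in> nbrs c i V v}" for x
    have "\<exists>x\<in>V - S. card T' * (D - s) \<le> card (N x) * card V"
    proof (rule ccontr)
      assume "\<not> ?thesis"
      \<comment> \<open>the summand 1 keeps the inequality strict after summation\<close>
      then have "(\<Sum>x\<in>V - S. card (N x) * card V + 1) \<le> (\<Sum>x\<in>V - S. card T' * (D - s))"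
        by (intro sum_mono) (auto simp: not_le Suc_le_eq)
      then have "(\<Sum>x\<in>V - S. card (N x)) * card V + card (V - S) \<le> card (V - S) * (card T' * (D - s))"
        by (simp add: sum_Suc sum_distrib_right)
      also have "\<dots> \<le> card V * (card T' * (D - s))"
        using assms(1) by (intro mult_right_mono card_mono) auto
      also have "card T' * (D - s) \<le> (\<Sum>v\<in>T'. card (nbrs c i V v - S))"
      proof -
        have "D - s \<le> card (nbrs c i V v - S)" if "v \<in> T'" for v
        proof -
          have "D \<le> card (nbrs c i V v)" using that S(3) assms(4) by blast
          then show ?thesis
            using diff_card_le_card_Diff[OF finS, of "nbrs c i V v"] S(2) Suc.prems by linarith
        qed
        then have "(\<Sum>v\<in>T'. D - s) \<le> (\<Sum>v\<in>T'. card (nbrs c i V v - S))" by (rule sum_mono)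
        then show ?thesis by simp
      qed
      also have "(\<Sum>v\<in>T'. card (nbrs c i V v - S)) = (\<Sum>v\<in>T'. card {x \<in> V - S. x \<in> nbrs c i V v})"
        by (intro sum.cong arg_cong[where f = card]) (auto simp: nbrs_def)
      also have "\<dots> = (\<Sum>x\<in>V - S. card (N x))"
        using sum_multicount_gen[OF finT, of "V - S" "\<lambda>v x. x \<in> nbrs c i V v" "\<lambda>x. card (N x)"] assms(1)
        by (auto simp: N_def)
      finally have "card (V - S) = 0" by (simp add: mult.commute)
      moreover have "l < card V" using Suc.prems \<open>s \<le> D\<close> assms(3) by linarith
      ultimately show False using diff_card_le_card_Diff[OF finS, of V] S(2) by linarith
    qed
    then obtain x where x: "x \<in> V" "x \<notin> S" "card T' * (D - s) \<le> card (N x) * card V" by blast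
    have "card T * (D - s) ^ Suc l = (card T * (D - s) ^ l) * (D - s)" by simp
    also have "\<dots> \<le> (card T' * card V ^ l) * (D - s)" using S(5) by (rule mult_right_mono) simp
    also have "\<dots> = (card T' * (D - s)) * card V ^ l" by simp
    also have "\<dots> \<le> (card (N x) * card V) * card V ^ l" using x(3) by (rule mult_right_mono) simp
    finally have "card T * (D - s) ^ Suc l \<le> card (N x) * card V ^ Suc l" by simp
    moreover have "card (insert x S) = Suc l" using x(2) finS S(2) by simp
    moreover have "\<forall>v\<in>N x. insert x S \<subseteq> nbrs c i V v" "N x \<subseteq> T" using S(3,4) by (auto simp: N_def)
    ultimately show ?case using S(1) x(1) by (intro exI[of _ "insert x S"] exI[of _ "N x"]) auto
  qed
  then show ?thesis by blast
qed

lemma embeds_biclique: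
  assumes "finite S" "card S = s" "n - s \<le> card T" "finite T" "\<forall>v\<in>T. S \<subseteq> nbrs c i V v" "s \<le> n"
  shows "embeds_in_colour c i (biclique s n) (S \<union> T)"
proof -
  obtain R where R: "R \<subseteq> T" "card R = n - s" "finite R"
    using assms(3) by (metis obtain_subset_with_card_n)
  obtain f where f: "bij_betw f {..<s} S"
    using finite_same_card_bij[of "{..<s}" S] assms(1,2) by auto
  obtain g where g: "bij_betw g {s..<n} R"
    using finite_same_card_bij[of "{s..<n}" R] R by auto
  define \<phi> where "\<phi> x = (if x < s then f x else g x)" for x
  have bf: "bij_betw \<phi> {..<s} S" using f by (subst bij_betw_cong[of _ _ f]) (auto simp: \<phi>_def)
  have bg: "bij_betw \<phi> {s..<n} R" using g by (subst bij_betw_cong[of _ _ g]) (auto simp: \<phi>_def)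
  have "S \<inter> R = {}" using R(1) assms(5) by (auto simp: nbrs_def)
  then have "bij_betw \<phi> ({..<s} \<union> {s..<n}) (S \<union> R)" using bf bg by (intro bij_betw_combine)
  moreover have "{..<s} \<union> {s..<n} = {..<n}" using assms(6) by auto
  ultimately have bij: "bij_betw \<phi> {..<n} (S \<union> R)" by simp
  have "c {\<phi> u, \<phi> v} = i" if "u < s" "s \<le> v" "v < n" for u v
  proof -
    have "\<phi> u \<in> S" "\<phi> v \<in> R" using bf bg that by (auto simp: bij_betw_def)
    then have "\<phi> u \<in> nbrs c i V (\<phi> v)" using R(1) assms(5) by blast
    then show ?thesis by (simp add: nbrs_def insert_commute)
  qed
  then show ?thesis
    using bij R(1) unfolding embeds_in_colour_def biclique_def bij_betw_def
    by (intro exI[of _ \<phi>]) auto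
qed

text \<open>
  At least half of the vertices have the same majority colour. Choosing \<open>s\<close> common neighbours
  greedily for these costs a factor slightly larger than 2 in each step; as \<open>s\<^sup>2\<close> is small compared
  with the number of vertices, the total loss is at most \<open>2 * 2 ^ s\<close> by the inequality of Bernoulli.
\<close>

lemma ramsey_number_biclique_upper:
  assumes "s < n"
  shows "ramsey_number (biclique s n) \<le> 2 ^ (s + 2) * n"
proof (rule ramsey_number_leI)
  define N where "N = 2 ^ (s + 2) * n"
  show "1 \<le> 2 ^ (s + 2) * n" using assms by simp
  have sN: "4 * (s * (s + 1)) \<le> N"
  proof -
    have "s < 2 ^ s" by simp
    then have "s * (s + 1) \<le> 2 ^ s * n" using assms by (intro mult_mono) auto
    then show ?thesis by (simp add: N_def)
  qed
  have evenN: "N = 2 * (N div 2)" and N0: "0 < N" using assms by (auto simp: N_def)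
  fix c :: "nat set \<Rightarrow> colour"
  define V where "V = {..<N}"
  have V: "finite V" "card V = N" by (auto simp: V_def)
  define D where "D = N div 2 - 1"
  define T where "T i = {v \<in> V. D < card (nbrs c i V v)}" for i
  have "V = T Red \<union> T Blue"
  proof
    show "V \<subseteq> T Red \<union> T Blue"
    proof
      fix v assume v: "v \<in> V"
      have "N = Suc (card (nbrs c Red V v) + card (nbrs c Blue V v))"
        using card_nbrs_split[OF V(1) v colour.distinct(1), of c] V(2) by simp
      then have "D < card (nbrs c Red V v) \<or> D < card (nbrs c Blue V v)"
        unfolding D_def using evenN N0 by linarith
      then show "v \<in> T Red \<union> T Blue" using v by (auto simp: T_def)
    qed
  qed (auto simp: T_def)
  then have "N \<le> card (T Red) + card (T Blue)" using V(2) card_Un_le by metis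
  then obtain i where i: "N \<le> 2 * card (T i)" by (metis add_le_mono mult_2 nle_le order_trans)
  show "\<exists>i. embeds_in_colour c i (biclique s n) {..<2 ^ (s + 2) * n}"
  proof -
    have "s \<le> D" and DN: "D \<le> N" using sN evenN assms unfolding D_def by (auto simp: algebra_simps)
    note \<open>s \<le> D\<close>
    moreover have "D \<le> card (nbrs c i V v)" if "v \<in> T i" for v using that by (simp add: T_def)
    ultimately obtain S T' where S: "S \<subseteq> V" "card S = s" "T' \<subseteq> T i" "\<forall>v\<in>T'. S \<subseteq> nbrs c i V v"
      "card (T i) * (D - s) ^ s \<le> card T' * N ^ s"
      using ex_large_joint_nbhd[OF V(1), of "T i" D c i s] V(2) DN by (auto simp: T_def)
    have "n \<le> card T'"
    proof -
      define x where "x = - (2 * real s + 2) / real N"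
      have y: "2 * (real D - real s) = real N * (1 + x)"
        using N0 evenN unfolding x_def D_def by (simp add: field_simps)
      have "2 * (s + 1) \<le> N" using sN assms by (cases s) (auto simp: N_def)
      then have "real (2 * (s + 1)) \<le> real N" by (simp only: of_nat_le_iff)
      then have "2 * real s + 2 \<le> real N" by simp
      then have "- 1 \<le> x" using N0 by (simp add: x_def field_simps)
      then have "1 + real s * x \<le> (1 + x) ^ s" by (rule Bernoulli_inequality)
      moreover have "1 / 2 \<le> 1 + real s * x"
      proof -
        have "4 * (real s * (real s + 1)) \<le> real N"
          using sN by (metis of_nat_1 of_nat_add of_nat_le_iff of_nat_mult of_nat_numeral)
        then show ?thesis using N0 by (simp add: x_def field_simps)
      qed
      ultimately have "1 \<le> 2 * (1 + x) ^ s" by linarith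
      then have "real N ^ s * 1 \<le> real N ^ s * (2 * (1 + x) ^ s)" by (rule mult_left_mono) simp
      also have "\<dots> = 2 * (2 * (real D - real s)) ^ s" unfolding y by (simp add: power_mult_distrib)
      also have "\<dots> = 2 * (2 ^ s * (real D - real s) ^ s)" by (simp only: power_mult_distrib)
      also have "\<dots> = real (2 ^ (s + 1) * (D - s) ^ s)"
        using \<open>s \<le> D\<close> by (simp add: of_nat_diff)
      finally have "N ^ s \<le> 2 ^ (s + 1) * (D - s) ^ s"
        by (metis mult.right_neutral of_nat_le_iff of_nat_power)
      then have "N * N ^ s \<le> (2 * card (T i)) * (2 ^ (s + 1) * (D - s) ^ s)"
        using i by (rule mult_le_mono[rotated])
      also have "\<dots> = 2 ^ (s + 2) * (card (T i) * (D - s) ^ s)" by simp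
      also have "\<dots> \<le> 2 ^ (s + 2) * (card T' * N ^ s)" using S(5) by (rule mult_le_mono2)
      finally have "N \<le> 2 ^ (s + 2) * card T'" using N0 by simp
      then show ?thesis by (simp add: N_def)
    qed
    moreover have "finite S" "finite T'"
      using S(1,3) V(1) by (auto intro: finite_subset simp: T_def)
    ultimately have "embeds_in_colour c i (biclique s n) (S \<union> T')"
      using S(2,4) assms by (intro embeds_biclique) auto
    moreover have "S \<union> T' \<subseteq> {..<2 ^ (s + 2) * n}" using S(1,3) by (auto simp: T_def V_def N_def)
    ultimately show ?thesis unfolding embeds_in_colour_def by (meson order_trans)
  qed
qed simp

section \<open>Interpolation between n and the Ramsey number of the complete graph\<close>

lemma ramsey_number_planted_clique_lower:
  assumes "m \<le> n"
  shows "ramsey_number (complete_graph m) \<le> ramsey_number (planted_clique k m n)"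
proof (rule ramsey_number_mono)
  have "e \<in> edges (planted_clique k m n)" if e_in: "e \<in> [{..<m}]\<^bsup>2\<^esup>" for e
  proof -
    obtain x y where e: "e = {x, y}" "x < m" "y < m" "x \<noteq> y"
      using nsets2_E[OF e_in] by (metis lessThan_iff)
    define u v where "u = min x y" and "v = max x y"
    have "e = {u, v}" "u < v" "v < n" "v < m"
      using e assms unfolding u_def v_def by (auto simp: min_def max_def)
    then show ?thesis unfolding planted_clique_def by auto
  qed
  then show "contains_copy (planted_clique k m n) (complete_graph m)"
    using assms unfolding contains_copy_def
    by (intro exI[of _ id]) (auto simp: planted_clique_def complete_graph_def)
qed simp_all

text \<open>
  The central estimate: enlarging the planted clique by one vertex raises the Ramsey number by at
  most a constant factor, as long as it is at least a certain power of \<open>n\<close>. Some lower bound in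
  terms of \<open>n\<close> is unavoidable: a disjoint union of \<open>m\<close> red cliques on \<open>n - 1\<close> vertices, with all
  other edges blue, shows that the left-hand side exceeds \<open>m * (n - 1)\<close>.
\<close>

lemma ramsey_number_planted_clique_upper:
  assumes "1 \<le> k" "k \<le> m" "m < n"
  shows "ramsey_number (planted_clique k (Suc m) n) \<le>
    4 ^ k * (162 ^ k * (2 ^ 14 * max (ramsey_number (complete_graph m)) (n ^ (2 * k + 4))))"
    (is "_ \<le> ?N")
proof (rule ramsey_number_leI)
  show "1 \<le> ?N"
    using ramsey_number_arrows(1)[OF simple_complete_graph, of m] by (simp add: less_max_iff_disj Suc_le_eq)
  fix c :: "nat set \<Rightarrow> colour"
  have "1 \<le> m" "m \<le> n" using assms by auto
  moreover have "?N \<le> card {..<?N}" by simp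
  ultimately obtain i X W Q where *: "X \<subseteq> {..<?N}" "W \<subseteq> {..<?N}" "book c i X W" "card X = k"
    "n \<le> card W" "Q \<subseteq> W" "mono_clique c i Q" "card Q = m"
    using ex_book_with_clique[OF finite_lessThan _ _ ramsey_number_complete_graph_lower] by meson
  have "finite X" "finite W" using *(1,2) by (auto intro: finite_subset)
  then have "embeds_in_colour c i (planted_clique k (Suc m) n) (X \<union> W)"
    using * assms by (intro embeds_planted_clique) auto
  moreover have "X \<union> W \<subseteq> {..<?N}" using *(1,2) by simp
  ultimately show "\<exists>i. embeds_in_colour c i (planted_clique k (Suc m) n) {..<?N}"
    unfolding embeds_in_colour_def by (meson order_trans)
qed simp

text \<open>
  From \<open>p + 1 \<le> 2 ^ p\<close> with \<open>p = l div 4\<close>: three factors \<open>p + 1\<close> are available, two for the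
  square and one for the constant.
\<close>

lemma square_le_two_power:
  assumes "256 * b\<^sup>2 \<le> l"
  shows "4 * (b * (l + 1))\<^sup>2 \<le> (2::nat) ^ l"
proof -
  define p where "p = l div 4"
  have p: "l + 1 \<le> 4 * (p + 1)" "4 * p \<le> l"
    using dividend_less_times_div[of 4 l] times_div_less_eq_dividend[of 4 l] by (auto simp: p_def)
  have b: "64 * b\<^sup>2 \<le> p + 1" using assms unfolding p_def by linarith
  have "4 * (b * (l + 1))\<^sup>2 \<le> 4 * (b * (4 * (p + 1)))\<^sup>2"
    using p(1) by (intro mult_le_mono2 power_mono) auto
  also have "\<dots> = (64 * b\<^sup>2) * (p + 1)\<^sup>2" by (simp only: power_mult_distrib) simp
  also have "\<dots> \<le> (p + 1) * (p + 1)\<^sup>2" using b by (rule mult_right_mono) simp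
  also have "\<dots> = (p + 1) ^ 3" by (simp add: power2_eq_square power3_eq_cube)
  also have "\<dots> \<le> (2 ^ p) ^ 3"
  proof (rule power_mono)
    show "p + 1 \<le> 2 ^ p" using less_exp[of p] by linarith
  qed simp
  also have "\<dots> = 2 ^ (3 * p)" by (simp add: mult.commute flip: power_mult)
  also have "\<dots> \<le> 2 ^ l" using p(2) by (intro power_increasing) auto
  finally show ?thesis .
qed

text \<open>
  The Ramsey number of \<open>biclique s n\<close> is \<open>2 ^ s * n\<close> up to constant factors, and \<open>s\<close> is the least value
  for which this reaches \<open>f\<close>. As \<open>f\<close> is polynomial in \<open>n\<close>, it is of order \<open>log n\<close>; here \<open>l\<close> is
  the binary logarithm of \<open>n\<close>, rounded down.
\<close>

lemma ex_biclique_of_ramsey_number: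
  assumes l: "2 ^ l \<le> n" "n < 2 ^ (l + 1)" and big: "4 * ((a + k + 6) * (l + 1))\<^sup>2 \<le> 2 ^ l"
    and f: "n \<le> f" "f \<le> n ^ a"
  shows "\<exists>s\<ge>k. s + k \<le> n \<and> f \<le> ramsey_number (biclique s n) \<and>
    ramsey_number (biclique s n) \<le> (2 ^ (k + 2) + 256) * f"
proof -
  define P where "P s \<longleftrightarrow> k \<le> s \<and> 32 * f \<le> 2 ^ s * n" for s
  define s0 where "s0 = (a + k + 5) * (l + 1)"
  define s where "s = (LEAST s. P s)"
  have n1: "1 \<le> n" using l(1) by (metis le_trans one_le_numeral one_le_power)
  have "P s0"
  proof -
    have "n ^ a \<le> (2 ^ (l + 1)) ^ a" using l(2) by (intro power_mono) auto
    also have "(2 ^ (l + 1)) ^ a = (2::nat) ^ ((l + 1) * a)" by (rule power_mult[symmetric])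
    finally have "32 * f \<le> 2 ^ 5 * 2 ^ ((l + 1) * a)" using f(2) by simp
    also have "\<dots> = 2 ^ (5 + (l + 1) * a)" by (rule power_add[symmetric])
    also have "\<dots> \<le> 2 ^ s0" by (rule power_increasing) (simp_all add: s0_def algebra_simps)
    also have "\<dots> \<le> 2 ^ s0 * n" using n1 by simp
    finally show ?thesis by (simp add: P_def s0_def)
  qed
  then have s: "P s" "s \<le> s0" unfolding s_def by (auto intro: LeastI Least_le)
  have ks: "k \<le> s" and fs: "32 * f \<le> 2 ^ s * n" using s(1) by (auto simp: P_def)
  define t where "t = (a + k + 6) * (l + 1)"
  have "t = s0 + (l + 1)" by (simp add: t_def s0_def algebra_simps)
  then have t: "s + (l + 1) \<le> t" "k \<le> t" "1 \<le> t" using s(2) by (auto simp: s0_def)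
  have "t \<le> t\<^sup>2" by (simp add: power2_eq_square)
  have "4 * t\<^sup>2 \<le> n" using big l(1) unfolding t_def by linarith
  then have tn: "4 * t \<le> n" using \<open>t \<le> t\<^sup>2\<close> by linarith
  have "s * (s + (l + 1)) + 1 < n"
  proof -
    have "s * (s + (l + 1)) \<le> t * t" using t(1) by (intro mult_le_mono) auto
    also have "\<dots> = t\<^sup>2" by (simp add: power2_eq_square)
    finally show ?thesis using \<open>4 * t\<^sup>2 \<le> n\<close> \<open>t \<le> t\<^sup>2\<close> t(3) by linarith
  qed
  then have "2 ^ s * n < 32 * ramsey_number (biclique s n)"
    using t tn l(2) by (intro ramsey_number_biclique_lower[of s n "l + 1"]) auto
  then have lower: "f \<le> ramsey_number (biclique s n)" using fs by linarith
  have "2 ^ (s + 2) * n \<le> (2 ^ (k + 2) + 256) * f"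
  proof (cases "s = k")
    case True
    then show ?thesis using f(1) by (intro mult_le_mono) auto
  next
    case False
    then obtain r where r: "s = Suc r" "k \<le> r" using ks by (cases s) auto
    have "\<not> P r" using not_less_Least[of r P] r(1) unfolding s_def by (metis lessI)
    then have "2 ^ r * n < 32 * f" using r(2) by (auto simp: P_def)
    moreover have "2 ^ (s + 2) * n = 8 * (2 ^ r * n)" by (simp add: r(1))
    ultimately have "2 ^ (s + 2) * n \<le> 256 * f" by linarith
    also have "\<dots> \<le> (2 ^ (k + 2) + 256) * f" by (rule mult_right_mono) simp_all
    finally show ?thesis .
  qed
  moreover have "ramsey_number (biclique s n) \<le> 2 ^ (s + 2) * n"
    using t tn by (intro ramsey_number_biclique_upper) auto
  ultimately show ?thesis using ks lower t tn by (intro exI[of _ s]) auto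
qed

text \<open>
  The clique is the smallest one whose own Ramsey number reaches \<open>f\<close>. The clique with one vertex
  less has a Ramsey number below \<open>f\<close>, unless it has only \<open>k\<close> vertices; the factor
  \<open>ramsey_number (complete_graph k)\<close> covers that case.
\<close>

lemma ex_planted_clique_of_ramsey_number:
  assumes "1 \<le> k" "k < n" "n ^ (2 * k + 4) \<le> f" "f \<le> ramsey_number (complete_graph n)"
  shows "\<exists>m. f \<le> ramsey_number (planted_clique k m n) \<and>
    ramsey_number (planted_clique k m n) \<le>
      4 ^ k * (162 ^ k * 2 ^ 14) * ramsey_number (complete_graph k) * f"
proof -
  define P where "P m \<longleftrightarrow> k < m \<and> f \<le> ramsey_number (complete_graph m)" for m
  define m where "m = (LEAST m. P m)"
  have "P n" using assms by (simp add: P_def)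
  then have m: "P m" "m \<le> n" unfolding m_def by (auto intro: LeastI Least_le)
  then obtain m' where m': "m = Suc m'" "k \<le> m'" by (cases m) (auto simp: P_def)
  have "0 < n ^ (2 * k + 4)" using assms(2) by simp
  then have f1: "1 \<le> f" using assms(3) by linarith
  have r1: "1 \<le> ramsey_number (complete_graph k)" by (rule ramsey_number_arrows) simp
  have "ramsey_number (complete_graph m') \<le> ramsey_number (complete_graph k) * f"
  proof (cases "m' = k")
    case True
    then show ?thesis using f1 by simp
  next
    case False
    have "\<not> P m'" using not_less_Least[of m' P] m'(1) unfolding m_def by (metis lessI)
    then have "ramsey_number (complete_graph m') \<le> 1 * f" using False m'(2) by (auto simp: P_def)
    also have "\<dots> \<le> ramsey_number (complete_graph k) * f" using r1 by (rule mult_right_mono) simp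
    finally show ?thesis .
  qed
  moreover have "1 * n ^ (2 * k + 4) \<le> ramsey_number (complete_graph k) * f"
    using r1 assms(3) by (rule mult_le_mono)
  ultimately have "max (ramsey_number (complete_graph m')) (n ^ (2 * k + 4)) \<le> ramsey_number (complete_graph k) * f"
    by simp
  then have "4 ^ k * (162 ^ k * (2 ^ 14 * max (ramsey_number (complete_graph m')) (n ^ (2 * k + 4)))) \<le>
      4 ^ k * (162 ^ k * (2 ^ 14 * (ramsey_number (complete_graph k) * f)))"
    by (intro mult_le_mono2)
  then have "ramsey_number (planted_clique k m n) \<le>
      4 ^ k * (162 ^ k * (2 ^ 14 * (ramsey_number (complete_graph k) * f)))"
    using ramsey_number_planted_clique_upper[OF assms(1) m'(2), of n] m(2) m'(1) by (meson Suc_le_lessD order_trans)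
  moreover have "f \<le> ramsey_number (planted_clique k m n)"
    using m(1) ramsey_number_planted_clique_lower[OF m(2), of k] by (auto simp: P_def)
  ultimately show ?thesis by (intro exI[of _ m]) (simp add: mult.assoc)
qed

text \<open>
  For small \<open>n\<close> the complete graph serves, with a constant that bounds its Ramsey number. Each of the
  three ranges contributes one summand to \<open>C\<close>.
\<close>

lemma ex_graph_of_ramsey_number:
  assumes "1 \<le> k"
  shows "\<exists>C::nat. C > 0 \<and> (\<forall>n f. 1 \<le> n \<longrightarrow> n \<le> f \<longrightarrow> f \<le> ramsey_number (complete_graph n) \<longrightarrow>
    (\<exists>G :: nat sgraph. simple_graph G \<and> k_connected k G \<and> card (verts G) = n \<and>
      f \<le> ramsey_number G \<and> ramsey_number G \<le> C * f))"
proof -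
  define b where "b = 2 * k + 4 + k + 6"
  \<comment> \<open>for \<open>n \<ge> n0\<close> the logarithm of \<open>n\<close> is large enough for \<open>square_le_two_power\<close>\<close>
  define n0 :: nat where "n0 = 2 ^ (256 * b\<^sup>2)"
  define C1 :: nat where "C1 = 2 ^ (k + 2) + 256"
  define C2 where "C2 = 4 ^ k * (162 ^ k * 2 ^ 14) * ramsey_number (complete_graph k)"
  define C3 where "C3 = (\<Sum>n<n0. ramsey_number (complete_graph n))"
  define C where "C = C1 + C2 + C3"
  have "\<exists>G :: nat sgraph. simple_graph G \<and> k_connected k G \<and> card (verts G) = n \<and>
      f \<le> ramsey_number G \<and> ramsey_number G \<le> C * f"
    if n: "1 \<le> n" "n \<le> f" "f \<le> ramsey_number (complete_graph n)" for n f
  proof (cases "n < n0")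
    case True
    have "ramsey_number (complete_graph n) \<le> C3" unfolding C3_def by (rule member_le_sum) (use True in auto)
    also have "C3 \<le> C * 1" by (simp add: C_def)
    also have "\<dots> \<le> C * f" using n by (intro mult_le_mono2) simp
    finally have "ramsey_number (complete_graph n) \<le> C * f" .
    moreover have "card (verts (complete_graph n)) = n" by (simp add: complete_graph_def)
    ultimately show ?thesis using n(3) k_connected_complete_graph
      by (intro exI[of _ "complete_graph n"]) simp
  next
    case False
    obtain l where l: "2 ^ l \<le> n" "n < 2 ^ (l + 1)" using ex_power_ivl1[of 2 n] n(1) by auto
    have "(2::nat) ^ (256 * b\<^sup>2) < 2 ^ (l + 1)" using False l(2) unfolding n0_def by linarith
    then have "256 * b\<^sup>2 < l + 1" by (rule power_less_imp_less_exp[rotated]) simp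
    then have "256 * b\<^sup>2 \<le> l" by simp
    then have big: "4 * (b * (l + 1))\<^sup>2 \<le> 2 ^ l" by (rule square_le_two_power)
    have "k < 4 * (b * (l + 1))\<^sup>2"
    proof -
      have "b * 1 \<le> b * (l + 1)" by (rule mult_le_mono2) simp
      also have "\<dots> \<le> (b * (l + 1))\<^sup>2" by (rule self_le_power) (auto simp: b_def)
      finally show ?thesis by (simp add: b_def)
    qed
    then have kn: "k < n" using big l(1) by linarith
    show ?thesis
    proof (cases "f \<le> n ^ (2 * k + 4)")
      case True
      obtain s where s: "k \<le> s" "s + k \<le> n" "f \<le> ramsey_number (biclique s n)"
        "ramsey_number (biclique s n) \<le> C1 * f"
        using ex_biclique_of_ramsey_number[OF l big[unfolded b_def] n(2) True] unfolding C1_def by blast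
      have "C1 * f \<le> C * f" by (simp add: C_def)
      then have "ramsey_number (biclique s n) \<le> C * f" using s(4) by linarith
      moreover have "card (verts (biclique s n)) = n" by (simp add: biclique_def)
      ultimately show ?thesis using s k_connected_biclique by (intro exI[of _ "biclique s n"]) simp
    next
      case False
      obtain m where m: "f \<le> ramsey_number (planted_clique k m n)"
        "ramsey_number (planted_clique k m n) \<le> C2 * f"
        using ex_planted_clique_of_ramsey_number[OF assms kn _ n(3)] False unfolding C2_def by auto
      have "C2 * f \<le> C * f" by (simp add: C_def)
      then have "ramsey_number (planted_clique k m n) \<le> C * f" using m(2) by linarith
      moreover have "card (verts (planted_clique k m n)) = n" by (simp add: planted_clique_def)
      ultimately show ?thesis using m(1) k_connected_planted_clique kn
        by (intro exI[of _ "planted_clique k m n"]) simp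
    qed
  qed
  moreover have "C > 0" by (simp add: C_def C1_def)
  ultimately show ?thesis by blast
qed

theorem theorem3:
  fixes k :: nat
  assumes "k \<ge> 2"
  shows "\<exists>C :: real. C > 0 \<and>
    (\<forall>f :: nat \<Rightarrow> nat.
      (\<forall>n\<ge>1. n \<le> f n \<and> f n \<le> ramsey_number (complete_graph n)) \<longrightarrow>
      (\<exists>G :: nat \<Rightarrow> nat sgraph. \<forall>n\<ge>1.
        simple_graph (G n) \<and> k_connected k (G n) \<and> card (verts (G n)) = n \<and>
        f n \<le> ramsey_number (G n) \<and>
        real (ramsey_number (G n)) \<le> C * real (f n)))"
proof -
  obtain C :: nat where C: "C > 0"
    "\<And>n f. 1 \<le> n \<Longrightarrow> n \<le> f \<Longrightarrow> f \<le> ramsey_number (complete_graph n) \<Longrightarrow>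
      \<exists>G :: nat sgraph. simple_graph G \<and> k_connected k G \<and> card (verts G) = n \<and>
        f \<le> ramsey_number G \<and> ramsey_number G \<le> C * f"
    using ex_graph_of_ramsey_number[of k] assms by auto
  show ?thesis
  proof (intro exI[of _ "real C"] conjI allI impI)
    show "real C > 0" using C(1) by simp
    fix f :: "nat \<Rightarrow> nat"
    assume f: "\<forall>n\<ge>1. n \<le> f n \<and> f n \<le> ramsey_number (complete_graph n)"
    have "\<forall>n. \<exists>G :: nat sgraph. n \<ge> 1 \<longrightarrow> simple_graph G \<and> k_connected k G \<and> card (verts G) = n \<and>
        f n \<le> ramsey_number G \<and> ramsey_number G \<le> C * f n"
      using C(2) f by blast
    then obtain G :: "nat \<Rightarrow> nat sgraph" where G: "\<forall>n\<ge>1. simple_graph (G n) \<and> k_connected k (G n) \<and>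
        card (verts (G n)) = n \<and> f n \<le> ramsey_number (G n) \<and> ramsey_number (G n) \<le> C * f n"
      by metis
    then show "\<exists>G :: nat \<Rightarrow> nat sgraph. \<forall>n\<ge>1.
        simple_graph (G n) \<and> k_connected k (G n) \<and> card (verts (G n)) = n \<and>
        f n \<le> ramsey_number (G n) \<and> real (ramsey_number (G n)) \<le> real C * real (f n)"
      by (intro exI[of _ G]) (metis of_nat_le_iff of_nat_mult)
  qed
qed

end
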